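(* Let $\{p_{\boldsymbol\theta}\}$ be a $d$-parameter statistical model with parameter space $\Theta\subset\mathbb{R}^d$, satisfying (A1)--(A2) and (R1)--(R5) (listed in the context). For fixed $0<\delta<1/\sqrt{8\pi e}$ and $d<\infty$, let $M=M(\epsilon,\delta,d)$ be the minimal number of repetitions required to guarantee that the maximum-likelihood estimator satisfies $$\Pr\big[\|\tilde{\boldsymbol\theta}^{\mathrm{ML}}-\boldsymbol\theta\|_2\le\epsilon\big]\ge 1-\delta\quad\text{for all }\boldsymbol\theta\in\Theta ,$$ i.e. the minimal number $M_0$ such that this guarantee holds for all numbers of repetitions $\ge M_0$. Then, in the small-error limit $\epsilon\to0$, $$M\gtrsim W_0(\delta^{-2}/8\pi)\,\sup_{\boldsymbol\theta\in\Theta}\mu_{\max}(\mathbf F_{\boldsymbol\theta}^{-1})\,\epsilon^{-2} ,$$ where $\mu_{\max}(\mathbf F_{\boldsymbol\theta}^{-1})$ is the largest eigenvalue of $\mathbf F_{\boldsymbol\theta}^{-1}$. Equivalently, the minimal sample complexity $N_{\mathrm{samp}}=N_{\mathcal E}M$ is lower bounded as $$N_{\mathrm{samp}}\gtrsim N_{\mathcal E}\,W_0(\delta^{-2}/8\pi)\,\sup_{\boldsymbol\theta\in\Theta}\mu_{\max}(\mathbf F_{\boldsymbol\theta}^{-1})\,\epsilon^{-2} .$$ Here $A_\epsilon\gtrsim B_\epsilon$ means $\liminf_{\epsilon\to0}A_\epsilon/B_\epsilon\ge1$ with $\delta$ and $d$ fixed.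
   Context: Setting. $p_{\boldsymbol\theta}(x)$ is the probability of outcome $x$ in one run of a fixed quantum estimation protocol, $p_{\boldsymbol\theta}(x)=\mathrm{Tr}[\hat\Pi_x\mathcal E_{\boldsymbol\theta}(\hat\rho_0)]$, where $\hat\rho_0$ is a fixed state, $\mathcal E_{\boldsymbol\theta}$ a parametrized quantum channel that uses an elementary parameter-dependent channel a fixed number $N_{\mathcal E}$ of times, and $\{\hat\Pi_x\}_x$ a POVM. The protocol is repeated independently $M$ times, giving i.i.d. outcomes $\boldsymbol x=(x_1,\dots,x_M)$ with law $\prod_i p_{\boldsymbol\theta}(x_i)$, $\boldsymbol\theta$ being the true parameter; $\Pr$ and $\mathbb E_{\boldsymbol\theta}$ refer to this law, and $X$ denotes a single outcome. The sample complexity is $N_{\mathrm{samp}}=MN_{\mathcal E}$. Notation. $\ell_{\boldsymbol\theta}(x)=\log p_{\boldsymbol\theta}(x)$, with gradient $\ell^{(1)}_{\boldsymbol\theta}(x)\in\mathbb R^d$, Hessian $\ell^{(2)}_{\boldsymbol\theta}(x)\in\mathbb R^{d\times d}$ and third-derivative tensor $\ell^{(3)}_{\boldsymbol\theta}(x)\in\mathbb R^{d\times d\times d}$ with respect to $\boldsymbol\theta$; $\ell_{\boldsymbol\theta}(\boldsymbol x)=\sum_{i=1}^M\ell_{\boldsymbol\theta}(x_i)$. The Fisher information matrix is $\mathbf F_{\boldsymbol\theta}=\mathbb E_{\boldsymbol\theta}[\ell^{(1)}_{\boldsymbol\theta}(X)\ell^{(1)}_{\boldsymbol\theta}(X)^{\mathsf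 T}]$, with $\mathbb E_{\boldsymbol\theta}[\ell^{(1)}_{\boldsymbol\theta}(X)]=0$ and $\mathbb E_{\boldsymbol\theta}[\ell^{(2)}_{\boldsymbol\theta}(X)]=-\mathbf F_{\boldsymbol\theta}$. $\tilde{\boldsymbol\theta}^{\mathrm{ML}}=\tilde{\boldsymbol\theta}^{\mathrm{ML}}(\boldsymbol x)$ is the maximizer of $\boldsymbol\theta\mapsto\ell_{\boldsymbol\theta}(\boldsymbol x)$ over $\Theta$. $\|\cdot\|_2$ on vectors is the Euclidean norm. $\|\cdot\|_{\mathrm{op}}$ is the Euclidean operator norm for matrices, and for a third-order tensor $\mathbf T$ it is $\sup|\sum_{ijk}T_{ijk}u_iv_jw_k|$ over Euclidean unit vectors $u,v,w$. $W_0$ is the principal branch of the Lambert $W$ function. Assumptions. (A1) Unique maximizer and stationary point: $\ell_{\boldsymbol\theta}(\boldsymbol x)$ has a unique maximizer $\tilde{\boldsymbol\theta}^{\mathrm{ML}}$ in the interior of the parameter domain $\Theta$, which is also the unique stationary point. (A2) Smoothness: $\ell_{\boldsymbol\theta}(\boldsymbol x)$ is three times continuously differentiable with respect to $\boldsymbol\theta$ on the parameter domain $\Theta$. (R1) Let $\widetilde\Theta$ be an open ambient parameter domain containing $\Theta$. There exists $r_0>0$ such that $\boldsymbol\theta+\boldsymbol\Delta\in\widetilde\Theta$ for all $\boldsymbol\theta\in\Theta$ and $\|\boldsymbol\Delta\|_2\le r_0$. (R2) $\mathbf F_{\boldsymbol\theta}$ is non-singular for every $\boldsymbol\theta\in\Theta$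 and $\sup_{\boldsymbol\theta\in\Theta}\|\mathbf F_{\boldsymbol\theta}^{-1}\|_{\mathrm{op}}<\infty$. (R3) $\sup_{\boldsymbol\theta\in\Theta}\mathbb E_{\boldsymbol\theta}[\mathrm{Tr}\{(\ell^{(2)}_{\boldsymbol\theta}(X)+\mathbf F_{\boldsymbol\theta})^2\}]<\infty$. (R4) $\sup_{\boldsymbol\theta\in\Theta}\mathbb E_{\boldsymbol\theta}[(\sup_{\|\boldsymbol\Delta\|_2\le r_0}\|\ell^{(3)}_{\boldsymbol\theta+\boldsymbol\Delta}(X)\|_{\mathrm{op}})^2]<\infty$. (R5) $\sup_{\boldsymbol\theta\in\Theta}\sup_{\|\boldsymbol u\|_2=1}\dfrac{\mathbb E_{\boldsymbol\theta}[|\boldsymbol u^{\mathsf T}\mathbf F_{\boldsymbol\theta}^{-1}\ell^{(1)}_{\boldsymbol\theta}(X)|^3]}{(\boldsymbol u^{\mathsf T}\mathbf F_{\boldsymbol\theta}^{-1}\boldsymbol u)^{3/2}}<\infty$. *)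

theory Defs
  imports "HOL-Probability.Probability"
begin

definition partial_deriv :: "'n::finite \<Rightarrow> (real^'n \<Rightarrow> real) \<Rightarrow> real^'n \<Rightarrow> real" where
  "partial_deriv i f x = deriv (\<lambda>t. f (x + t *\<^sub>R axis i 1)) 0"

definition grad :: "(real^'n::finite \<Rightarrow> real) \<Rightarrow> real^'n \<Rightarrow> real^'n" where
  "grad f x = (\<chi> i. partial_deriv i f x)"

definition hess :: "(real^'n::finite \<Rightarrow> real) \<Rightarrow> real^'n \<Rightarrow> real^'n^'n" where
  "hess f x = (\<chi> i j. partial_deriv i (partial_deriv j f) x)"

definition third_deriv :: "(real^'n::finite \<Rightarrow> real) \<Rightarrow> real^'n \<Rightarrow> real^'n^'n^'n" where
  "third_deriv f x = (\<chi> i j k. partial_deriv i (partial_deriv j (partial_deriv k f)) x)"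

text \<open>On an open set \<open>S\<close> this is the usual class of \<open>k\<close> times continuously
  differentiable functions.\<close>

fun Ck_on :: "nat \<Rightarrow> (real^'n::finite) set \<Rightarrow> (real^'n \<Rightarrow> real) \<Rightarrow> bool" where
  "Ck_on 0 S f \<longleftrightarrow> continuous_on S f"
| "Ck_on (Suc k) S f \<longleftrightarrow> f differentiable_on S \<and> (\<forall>i. Ck_on k S (partial_deriv i f))"

definition tensor_opnorm :: "real^'n^'n^('n::finite) \<Rightarrow> real" where
  "tensor_opnorm T =
     (SUP (u, v, w) \<in> sphere 0 1 \<times> sphere 0 1 \<times> sphere 0 1.
        \<bar>\<Sum>i\<in>UNIV. \<Sum>j\<in>UNIV. \<Sum>k\<in>UNIV. T $ i $ j $ k * u $ i * v $ j * w $ k\<bar>)"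

definition matrix_eigenvalue :: "real^'n^('n::finite) \<Rightarrow> real \<Rightarrow> bool" where
  "matrix_eigenvalue A \<mu> \<longleftrightarrow> (\<exists>v. v \<noteq> 0 \<and> A *v v = \<mu> *\<^sub>R v)"

text \<open>Used for symmetric matrices only, where all eigenvalues are real.\<close>

definition mu_max :: "real^'n^('n::finite) \<Rightarrow> real" where
  "mu_max A = (GREATEST \<mu>. matrix_eigenvalue A \<mu>)"

text \<open>Principal branch, meaningful for \<open>y \<ge> - exp (- 1)\<close>.\<close>

definition lambert_W0 :: "real \<Rightarrow> real" where
  "lambert_W0 y = (THE w. - 1 \<le> w \<and> w * exp w = y)"

text \<open>A model is given by densities \<open>p \<theta>\<close> with respect to a fixed measure \<open>\<nu>\<close> on the outcome
  space. Discrete outcomes are the case where \<open>\<nu>\<close> is a counting measure; then \<open>p \<theta> x\<close> is the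
  probability of the outcome \<open>x\<close>.\<close>

definition outcome_law :: "'x measure \<Rightarrow> (real^'n \<Rightarrow> 'x \<Rightarrow> real) \<Rightarrow> real^'n \<Rightarrow> 'x measure" where
  "outcome_law \<nu> p \<theta> = density \<nu> (\<lambda>x. ennreal (p \<theta> x))"

definition sample_law ::
    "'x measure \<Rightarrow> (real^'n \<Rightarrow> 'x \<Rightarrow> real) \<Rightarrow> nat \<Rightarrow> real^'n \<Rightarrow> (nat \<Rightarrow> 'x) measure" where
  "sample_law \<nu> p M \<theta> = PiM {..<M} (\<lambda>_. outcome_law \<nu> p \<theta>)"

definition loglik :: "(real^'n \<Rightarrow> 'x \<Rightarrow> real) \<Rightarrow> 'x \<Rightarrow> real^'n \<Rightarrow> real" where
  "loglik p x \<theta> = ln (p \<theta> x)"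

definition sample_loglik ::
    "(real^'n \<Rightarrow> 'x \<Rightarrow> real) \<Rightarrow> nat \<Rightarrow> (nat \<Rightarrow> 'x) \<Rightarrow> real^'n \<Rightarrow> real" where
  "sample_loglik p M xs \<theta> = (\<Sum>i<M. loglik p (xs i) \<theta>)"

definition mle ::
    "(real^'n \<Rightarrow> 'x \<Rightarrow> real) \<Rightarrow> (real^'n) set \<Rightarrow> nat \<Rightarrow> (nat \<Rightarrow> 'x) \<Rightarrow> real^'n" where
  "mle p \<Theta> M xs = arg_max_on (sample_loglik p M xs) \<Theta>"

definition score_outer ::
    "(real^'n::finite \<Rightarrow> 'x \<Rightarrow> real) \<Rightarrow> real^'n \<Rightarrow> 'x \<Rightarrow> real^'n^'n" where
  "score_outer p \<theta> x = (\<chi> i j. grad (loglik p x) \<theta> $ i * grad (loglik p x) \<theta> $ j)"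

definition fisher ::
    "'x measure \<Rightarrow> (real^'n::finite \<Rightarrow> 'x \<Rightarrow> real) \<Rightarrow> real^'n \<Rightarrow> real^'n^'n" where
  "fisher \<nu> p \<theta> = (\<integral>x. score_outer p \<theta> x \<partial>outcome_law \<nu> p \<theta>)"

text \<open>\<open>\<Theta>a\<close> is the open ambient parameter domain. Positivity of the densities makes the
  log-likelihood well defined there, so \<open>space \<nu>\<close> consists of the outcomes that can occur.\<close>

definition statistical_model ::
    "'x measure \<Rightarrow> (real^'n::finite \<Rightarrow> 'x \<Rightarrow> real) \<Rightarrow> (real^'n) set \<Rightarrow> (real^'n) set \<Rightarrow> bool" where
  "statistical_model \<nu> p \<Theta> \<Theta>a \<longleftrightarrow>
     \<Theta> \<noteq> {} \<and> open \<Theta>a \<and> \<Theta> \<subseteq> \<Theta>a \<and>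
     (\<forall>\<theta>\<in>\<Theta>a. p \<theta> \<in> borel_measurable \<nu> \<and> (\<forall>x\<in>space \<nu>. 0 < p \<theta> x)) \<and>
     (\<forall>\<theta>\<in>\<Theta>. prob_space (outcome_law \<nu> p \<theta>))"

text \<open>The Fisher information exists, the score has mean zero and the expected Hessian is minus
  the Fisher information.\<close>

definition score_identities ::
    "'x measure \<Rightarrow> (real^'n::finite \<Rightarrow> 'x \<Rightarrow> real) \<Rightarrow> (real^'n) set \<Rightarrow> bool" where
  "score_identities \<nu> p \<Theta> \<longleftrightarrow>
     (\<forall>\<theta>\<in>\<Theta>.
        integrable (outcome_law \<nu> p \<theta>) (score_outer p \<theta>) \<and>
        has_bochner_integral (outcome_law \<nu> p \<theta>) (\<lambda>x. grad (loglik p x) \<theta>) 0 \<and>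
        has_bochner_integral (outcome_law \<nu> p \<theta>) (\<lambda>x. hess (loglik p x) \<theta>) (- fisher \<nu> p \<theta>))"

definition A1 ::
    "'x measure \<Rightarrow> (real^'n::finite \<Rightarrow> 'x \<Rightarrow> real) \<Rightarrow> (real^'n) set \<Rightarrow> bool" where
  "A1 \<nu> p \<Theta> \<longleftrightarrow>
     (\<forall>M\<ge>1. \<forall>xs\<in>space (PiM {..<M} (\<lambda>_. \<nu>)). \<exists>\<theta>h\<in>interior \<Theta>.
        (\<forall>\<theta>. is_arg_max (sample_loglik p M xs) (\<lambda>\<theta>. \<theta> \<in> \<Theta>) \<theta> \<longleftrightarrow> \<theta> = \<theta>h) \<and>
        (\<forall>\<theta>\<in>\<Theta>. grad (sample_loglik p M xs) \<theta> = 0 \<longleftrightarrow> \<theta> = \<theta>h))"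

text \<open>Smoothness is required on the ambient domain, where \<open>R4\<close> below evaluates third
  derivatives.\<close>

definition A2 ::
    "'x measure \<Rightarrow> (real^'n::finite \<Rightarrow> 'x \<Rightarrow> real) \<Rightarrow> (real^'n) set \<Rightarrow> bool" where
  "A2 \<nu> p \<Theta>a \<longleftrightarrow>
     (\<forall>M\<ge>1. \<forall>xs\<in>space (PiM {..<M} (\<lambda>_. \<nu>)). Ck_on 3 \<Theta>a (sample_loglik p M xs))"

definition R1 :: "(real^'n::finite) set \<Rightarrow> (real^'n) set \<Rightarrow> real \<Rightarrow> bool" where
  "R1 \<Theta> \<Theta>a r0 \<longleftrightarrow> 0 < r0 \<and> (\<forall>\<theta>\<in>\<Theta>. \<forall>\<Delta>. norm \<Delta> \<le> r0 \<longrightarrow> \<theta> + \<Delta> \<in> \<Theta>a)"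

definition R2 ::
    "'x measure \<Rightarrow> (real^'n::finite \<Rightarrow> 'x \<Rightarrow> real) \<Rightarrow> (real^'n) set \<Rightarrow> bool" where
  "R2 \<nu> p \<Theta> \<longleftrightarrow>
     (\<forall>\<theta>\<in>\<Theta>. invertible (fisher \<nu> p \<theta>)) \<and>
     (SUP \<theta>\<in>\<Theta>. ennreal (onorm ((*v) (matrix_inv (fisher \<nu> p \<theta>))))) < \<infinity>"

definition R3 ::
    "'x measure \<Rightarrow> (real^'n::finite \<Rightarrow> 'x \<Rightarrow> real) \<Rightarrow> (real^'n) set \<Rightarrow> bool" where
  "R3 \<nu> p \<Theta> \<longleftrightarrow>
     (SUP \<theta>\<in>\<Theta>. \<integral>\<^sup>+x. ennreal (trace ((hess (loglik p x) \<theta> + fisher \<nu> p \<theta>) **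
                                    (hess (loglik p x) \<theta> + fisher \<nu> p \<theta>)))
                  \<partial>outcome_law \<nu> p \<theta>) < \<infinity>"

definition R4 ::
    "'x measure \<Rightarrow> (real^'n::finite \<Rightarrow> 'x \<Rightarrow> real) \<Rightarrow> (real^'n) set \<Rightarrow> real \<Rightarrow> bool" where
  "R4 \<nu> p \<Theta> r0 \<longleftrightarrow>
     (SUP \<theta>\<in>\<Theta>. \<integral>\<^sup>+x. (SUP \<Delta>\<in>cball 0 r0.
                       ennreal (tensor_opnorm (third_deriv (loglik p x) (\<theta> + \<Delta>))))\<^sup>2
                  \<partial>outcome_law \<nu> p \<theta>) < \<infinity>"

definition R5 ::
    "'x measure \<Rightarrow> (real^'n::finite \<Rightarrow> 'x \<Rightarrow> real) \<Rightarrow> (real^'n) set \<Rightarrow> bool" where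
  "R5 \<nu> p \<Theta> \<longleftrightarrow>
     (SUP \<theta>\<in>\<Theta>. SUP u\<in>sphere 0 1.
        (\<integral>\<^sup>+x. ennreal (\<bar>u \<bullet> (matrix_inv (fisher \<nu> p \<theta>) *v grad (loglik p x) \<theta>)\<bar> ^ 3)
           \<partial>outcome_law \<nu> p \<theta>) /
        ennreal ((u \<bullet> (matrix_inv (fisher \<nu> p \<theta>) *v u)) powr (3 / 2))) < \<infinity>"

definition ml_guarantee ::
    "'x measure \<Rightarrow> (real^'n::finite \<Rightarrow> 'x \<Rightarrow> real) \<Rightarrow> (real^'n) set \<Rightarrow> real \<Rightarrow> real \<Rightarrow> nat \<Rightarrow> bool"
  where
  "ml_guarantee \<nu> p \<Theta> \<epsilon> \<delta> M \<longleftrightarrow>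
     (\<forall>\<theta>\<in>\<Theta>. 1 - \<delta> \<le> measure (sample_law \<nu> p M \<theta>)
        {xs \<in> space (sample_law \<nu> p M \<theta>). norm (mle p \<Theta> M xs - \<theta>) \<le> \<epsilon>})"

text \<open>The value is \<open>\<infinity>\<close> if no number of repetitions suffices.\<close>

definition min_repetitions ::
    "'x measure \<Rightarrow> (real^'n::finite \<Rightarrow> 'x \<Rightarrow> real) \<Rightarrow> (real^'n) set \<Rightarrow> real \<Rightarrow> real \<Rightarrow> enat"
  where
  "min_repetitions \<nu> p \<Theta> \<epsilon> \<delta> =
     Inf (enat ` {M0. 1 \<le> M0 \<and> (\<forall>M\<ge>M0. ml_guarantee \<nu> p \<Theta> \<epsilon> \<delta> M)})"

text \<open>\<open>NE\<close> is the number of uses of the elementary channel in one repetition.\<close>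

definition min_sample_complexity ::
    "nat \<Rightarrow> 'x measure \<Rightarrow> (real^'n::finite \<Rightarrow> 'x \<Rightarrow> real) \<Rightarrow> (real^'n) set \<Rightarrow> real \<Rightarrow> real \<Rightarrow> enat"
  where
  "min_sample_complexity NE \<nu> p \<Theta> \<epsilon> \<delta> = enat NE * min_repetitions \<nu> p \<Theta> \<epsilon> \<delta>"

definition asymp_ge :: "(real \<Rightarrow> ereal) \<Rightarrow> (real \<Rightarrow> ereal) \<Rightarrow> bool" (infix "\<greatersim>" 50) where
  "A \<greatersim> B \<longleftrightarrow> 1 \<le> Liminf (at_right 0) (\<lambda>\<epsilon>. A \<epsilon> / B \<epsilon>)"

end

theory Submission
  imports Defs
begin

text \<open>Fix \<open>\<theta>\<close> and \<open>c\<close> with \<open>c < W\<^sub>0 \<mu>\<close>, where \<open>\<mu>\<close> is the largest eigenvalue of the inverse Fisher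
  matrix and \<open>u\<close> a corresponding unit eigenvector, and take \<open>M \<approx> c / \<epsilon>\<^sup>2\<close> repetitions. If the
  estimate lies within \<open>\<epsilon>\<close> of \<open>\<theta>\<close>, then expanding the likelihood equation around \<open>\<theta>\<close> and using
  laws of large numbers for the Hessian and for an envelope of the third derivatives bounds the score
  sum \<open>S\<close> in direction \<open>u\<close> by \<open>S / M \<le> \<epsilon> (1 / \<mu> + o(1))\<close>, outside events of vanishing probability.
  After normalization this is \<open>Z \<le> b\<close> with some \<open>b < sqrt W\<^sub>0\<close>, whose probability tends to the normal
  distribution function at \<open>b\<close> by the central limit theorem. The upper tail at \<open>b \<ge> 1\<close> is at least
  \<open>\<phi>(b) / (2 b)\<close> for the standard normal density \<open>\<phi>\<close>, which equals \<open>\<delta>\<close> at \<open>b = sqrt W\<^sub>0\<close> and is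
  larger before. Hence the guarantee fails for this \<open>M\<close>, and the minimal number of repetitions
  exceeds \<open>c / \<epsilon>\<^sup>2\<close>.\<close>

section \<open>Limit theorems for independent repetitions\<close>

text \<open>The joint law of the coordinates is the product measure itself, which is the product of
  their laws; composing with \<open>f\<close> preserves independence. The infinite product puts all
  sample sizes on one probability space, as the central limit theorem for a sequence
  demands.\<close>

lemma indep_vars_coordinates:
  fixes f :: "'x \<Rightarrow> real"
  assumes "prob_space P" and [measurable]: "f \<in> borel_measurable P"
  shows "prob_space.indep_vars (PiM UNIV (\<lambda>_::nat. P)) (\<lambda>_. borel) (\<lambda>i \<omega>. f (\<omega> i)) UNIV"
proof -
  let ?Q = "PiM UNIV (\<lambda>_::nat. P)"
  interpret P: prob_space P by fact
  interpret Q: prob_space ?Q by (intro prob_space_PiM assms)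
  have "Q.indep_vars (\<lambda>_. P) (\<lambda>i \<omega>. \<omega> i) UNIV"
  proof (subst Q.indep_vars_iff_distr_eq_PiM')
    have "distr ?Q ?Q (\<lambda>\<omega>. \<lambda>i\<in>UNIV. \<omega> i) = distr ?Q ?Q (\<lambda>\<omega>. \<omega>)"
      by (intro distr_cong) (auto simp: restrict_def)
    also have "\<dots> = ?Q" by (rule distr_id)
    also have "\<dots> = (\<Pi>\<^sub>M i\<in>UNIV. distr ?Q P (\<lambda>\<omega>. \<omega> i))"
      by (intro PiM_cong refl distr_PiM_component[symmetric] assms) auto
    finally show "distr ?Q ?Q (\<lambda>\<omega>. \<lambda>i\<in>UNIV. \<omega> i) = (\<Pi>\<^sub>M i\<in>UNIV. distr ?Q P (\<lambda>\<omega>. \<omega> i))" .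
  qed auto
  then show ?thesis
    by (rule Q.indep_vars_compose2) simp
qed

lemma distr_coordinate:
  assumes "prob_space P" and [measurable]: "f \<in> borel_measurable P"
  shows "distr (PiM UNIV (\<lambda>_::nat. P)) borel (\<lambda>\<omega>. f (\<omega> i)) = distr P borel f"
proof -
  have "distr P borel f = distr (distr (PiM UNIV (\<lambda>_::nat. P)) P (\<lambda>\<omega>. \<omega> i)) borel f"
    by (subst distr_PiM_component) (use assms in auto)
  also have "\<dots> = distr (PiM UNIV (\<lambda>_::nat. P)) borel (\<lambda>\<omega>. f (\<omega> i))"
    by (subst distr_distr) (auto simp: comp_def)
  finally show ?thesis ..
qed

lemma
  fixes f :: "'x \<Rightarrow> real"
  assumes "prob_space P" and [measurable]: "f \<in> borel_measurable P"
  shows integral_coordinate: "(\<integral>\<omega>. f (\<omega> i) \<partial>PiM UNIV (\<lambda>_::nat. P)) = (\<integral>x. f x \<partial>P)"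
    and integrable_coordinate:
      "integrable (PiM UNIV (\<lambda>_::nat. P)) (\<lambda>\<omega>. f (\<omega> i)) \<longleftrightarrow> integrable P f"
proof -
  have *: "distr (PiM UNIV (\<lambda>_::nat. P)) P (\<lambda>\<omega>. \<omega> i) = P"
    by (rule distr_PiM_component) (use assms in auto)
  show "(\<integral>\<omega>. f (\<omega> i) \<partial>PiM UNIV (\<lambda>_::nat. P)) = (\<integral>x. f x \<partial>P)"
    by (subst (2) *[symmetric], subst integral_distr) auto
  show "integrable (PiM UNIV (\<lambda>_::nat. P)) (\<lambda>\<omega>. f (\<omega> i)) \<longleftrightarrow> integrable P f"
    by (subst (2) *[symmetric], subst integrable_distr_eq) auto
qed

text \<open>Hoeffding's inequality for independent identically distributed variables;
  \<open>2 * K\<close> is the length of the interval \<open>{- K..K}\<close> that contains the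
  values of \<open>f\<close>.\<close>

lemma Hoeffding_coordinates:
  fixes f :: "'x \<Rightarrow> real"
  assumes "prob_space P" and [measurable]: "f \<in> borel_measurable P"
    and bd: "\<And>x. \<bar>f x\<bar> \<le> K" and "K > 0" "\<eta> \<ge> 0" "n > 0"
  shows "measure (PiM UNIV (\<lambda>_::nat. P))
     {\<omega> \<in> space (PiM UNIV (\<lambda>_::nat. P)). \<bar>(\<Sum>i<n. f (\<omega> i)) / n - (\<integral>x. f x \<partial>P)\<bar> \<ge> \<eta>}
       \<le> 2 * exp (- 2 * n * \<eta>\<^sup>2 / (2 * K)\<^sup>2)"
proof -
  let ?Q = "PiM UNIV (\<lambda>_::nat. P)"
  interpret Q: prob_space ?Q by (intro prob_space_PiM assms)
  have ne: "{..<n} \<noteq> {}" using \<open>n > 0\<close> by auto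
  interpret Hoeffding_ineq_iid ?Q "{..<n}" "\<lambda>i \<omega>. f (\<omega> i)" "\<lambda>\<omega>. f (\<omega> 0)" "-K" K
     "\<integral>\<omega>. f (\<omega> 0) \<partial>?Q"
  proof unfold_locales
    show "Q.indep_vars (\<lambda>_. borel) (\<lambda>i \<omega>. f (\<omega> i)) {..<n}"
      by (rule Q.indep_vars_subset[OF indep_vars_coordinates]) (use assms in auto)
    show "AE x in ?Q. f (x 0) \<in> {- K..K}"
      using bd by (intro AE_I2) (auto simp: abs_le_iff minus_le_iff)
  qed (use assms in \<open>auto simp: distr_coordinate\<close>)
  show ?thesis
    using Hoeffding_ineq_abs_ge'[OF \<open>\<eta> \<ge> 0\<close> _ ne] assms(4,6)
    unfolding integral_coordinate[OF assms(1,2)] by simp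
qed

text \<open>Applied later to the Hessian entries and to the envelopes of the third derivatives, both
  of which come with integrability.\<close>

lemma weak_law_of_large_numbers:
  fixes f :: "'x \<Rightarrow> real"
  assumes "prob_space P" and int: "integrable P f" and "\<eta> > 0"
  shows "(\<lambda>n. measure (PiM UNIV (\<lambda>_::nat. P))
     {\<omega> \<in> space (PiM UNIV (\<lambda>_::nat. P)). \<bar>(\<Sum>i<n. f (\<omega> i)) / n - (\<integral>x. f x \<partial>P)\<bar> \<ge> \<eta>}) \<longlonglongrightarrow> 0"
proof (rule LIMSEQ_I)
  let ?Q = "PiM UNIV (\<lambda>_::nat. P)"
  interpret P: prob_space P by fact
  interpret Q: prob_space ?Q by (intro prob_space_PiM assms)
  have [measurable]: "f \<in> borel_measurable P" using int by auto
  fix e :: real assume "e > 0"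
  \<comment> \<open>The bound \<open>\<eta> / 3\<close> lets the remainder average, the shift of the
    mean and the bounded part share the deviation \<open>\<eta>\<close> equally. The bound
    \<open>e * \<eta> / 12\<close> makes Markov's inequality at level \<open>\<eta> / 3\<close> give
    at most \<open>e / 4\<close>.\<close>
  define \<kappa> where "\<kappa> = min (\<eta> / 3) (e * \<eta> / 12)"
  have "\<kappa> > 0" "\<kappa> \<le> \<eta> / 3" "\<kappa> \<le> e * \<eta> / 12" using \<open>e > 0\<close> \<open>\<eta> > 0\<close> by (auto simp: \<kappa>_def)
  \<comment> \<open>Split \<open>f\<close> into a bounded truncation, controlled by Hoeffding's inequality, and a remainder of
    small \<open>L\<^sup>1\<close> norm, controlled by Markov's inequality.\<close>
  define g where "g k x = (if \<bar>f x\<bar> \<le> real k then f x else 0)" for k :: nat and x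
  have [measurable]: "g k \<in> borel_measurable P" for k unfolding g_def by measurable
  have g_le: "\<bar>g k x\<bar> \<le> \<bar>f x\<bar>" "\<bar>g k x\<bar> \<le> real k" for k x by (auto simp: g_def)
  have intg: "integrable P (g k)" for k
    by (rule Bochner_Integration.integrable_bound[OF int]) (auto simp: g_le)
  have "(\<lambda>k. \<integral>x. \<bar>f x - g k x\<bar> \<partial>P) \<longlonglongrightarrow> (\<integral>x. 0 \<partial>P)"
  proof (rule integral_dominated_convergence[where w="\<lambda>x. \<bar>f x\<bar>"])
    show "AE x in P. (\<lambda>k. \<bar>f x - g k x\<bar>) \<longlonglongrightarrow> 0"
    proof (rule AE_I2, rule tendsto_eventually)
      fix x
      obtain k0 where "\<bar>f x\<bar> \<le> real k0" using real_arch_simple by blast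
      then show "\<forall>\<^sub>F k in sequentially. \<bar>f x - g k x\<bar> = 0"
        by (intro eventually_sequentiallyI[of k0]) (auto simp: g_def)
    qed
  qed (use int in \<open>auto simp: g_def\<close>)
  then have "\<forall>\<^sub>F k in sequentially. (\<integral>x. \<bar>f x - g k x\<bar> \<partial>P) < \<kappa>"
    by (intro order_tendstoD(2)) (use \<open>\<kappa> > 0\<close> in auto)
  then obtain k where k: "(\<integral>x. \<bar>f x - g k x\<bar> \<partial>P) < \<kappa>" by (meson eventually_sequentially order_refl)
  \<comment> \<open>The summand 1 keeps the bound positive when \<open>k\<close> is 0, as
    Hoeffding's inequality is stated for positive \<open>K\<close>.\<close>
  let ?K = "real k + 1"
  define h where "h x = \<bar>f x - g k x\<bar>" for x
  have [measurable]: "h \<in> borel_measurable P" unfolding h_def by measurable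
  have h0: "0 \<le> h x" for x by (simp add: h_def)
  have [measurable]: "(\<lambda>\<omega>. h (\<omega> i)) \<in> borel_measurable ?Q" for i by measurable
  have inth: "integrable P h" unfolding h_def using int intg by (intro integrable_abs Bochner_Integration.integrable_diff)
  have inthQ: "integrable ?Q (\<lambda>\<omega>. h (\<omega> i))" and inthQ': "(\<integral>\<omega>. h (\<omega> i) \<partial>?Q) = (\<integral>x. h x \<partial>P)" for i
    using integrable_coordinate[of P h i] integral_coordinate[of P h i] assms(1) inth by auto
  have mean: "\<bar>(\<integral>x. g k x \<partial>P) - (\<integral>x. f x \<partial>P)\<bar> < \<kappa>"
  proof -
    have "\<bar>(\<integral>x. g k x \<partial>P) - (\<integral>x. f x \<partial>P)\<bar> = \<bar>\<integral>x. f x - g k x \<partial>P\<bar>"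
      using int intg by (subst Bochner_Integration.integral_diff) auto
    also have "\<dots> \<le> (\<integral>x. \<bar>f x - g k x\<bar> \<partial>P)" by (rule integral_abs_bound)
    finally show ?thesis using k by simp
  qed
  have "(\<lambda>n. 2 * exp (- 2 * real n * (\<eta>/3)\<^sup>2 / (2 * ?K)\<^sup>2)) \<longlonglongrightarrow> 0"
  proof -
    have "(\<lambda>n. 2 * exp (- ((2 * (\<eta>/3)\<^sup>2 / (2 * ?K)\<^sup>2)) * real n)) \<longlonglongrightarrow> 2 * 0"
    proof (intro tendsto_mult tendsto_const filterlim_compose[OF exp_at_bot])
      have "0 < 2 * (\<eta>/3)\<^sup>2 / (2 * ?K)\<^sup>2" using \<open>\<eta> > 0\<close> by simp
      then show "filterlim (\<lambda>n. - ((2 * (\<eta>/3)\<^sup>2 / (2 * ?K)\<^sup>2)) * real n) at_bot sequentially"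
        by (intro filterlim_tendsto_neg_mult_at_bot[OF tendsto_const] filterlim_real_sequentially) auto
    qed
    then show ?thesis by (simp add: field_simps)
  qed
  then have "\<forall>\<^sub>F n in sequentially. 2 * exp (- 2 * real n * (\<eta>/3)\<^sup>2 / (2 * ?K)\<^sup>2) < e / 2"
    by (rule order_tendstoD(2)) (use \<open>e > 0\<close> in simp)
  then obtain n0 where n0: "\<And>n. n \<ge> n0 \<Longrightarrow> 2 * exp (- 2 * real n * (\<eta>/3)\<^sup>2 / (2 * ?K)\<^sup>2) < e / 2"
    by (auto simp: eventually_sequentially)
  show "\<exists>no. \<forall>n\<ge>no. norm (measure ?Q
     {\<omega> \<in> space ?Q. \<bar>(\<Sum>i<n. f (\<omega> i)) / n - (\<integral>x. f x \<partial>P)\<bar> \<ge> \<eta>} - 0) < e"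
  proof (intro exI[of _ "max 1 n0"] allI impI)
    fix n assume "max 1 n0 \<le> n"
    then have n: "n > 0" "n \<ge> n0" by auto
    let ?A = "{\<omega> \<in> space ?Q. \<bar>(\<Sum>i<n. f (\<omega> i)) / n - (\<integral>x. f x \<partial>P)\<bar> \<ge> \<eta>}"
    let ?B = "{\<omega> \<in> space ?Q. \<bar>(\<Sum>i<n. g k (\<omega> i)) / n - (\<integral>x. g k x \<partial>P)\<bar> \<ge> \<eta> / 3}"
    let ?C = "{\<omega> \<in> space ?Q. (\<Sum>i<n. h (\<omega> i)) / n \<ge> \<eta> / 3}"
    have "?A \<subseteq> ?B \<union> ?C"
    proof safe
      fix \<omega> assume A: "\<eta> \<le> \<bar>(\<Sum>i<n. f (\<omega> i)) / n - (\<integral>x. f x \<partial>P)\<bar>"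
        and B: "\<not> \<eta> / 3 \<le> (\<Sum>i<n. h (\<omega> i)) / n"
      have "\<bar>(\<Sum>i<n. f (\<omega> i)) / n - (\<Sum>i<n. g k (\<omega> i)) / n\<bar> = \<bar>\<Sum>i<n. f (\<omega> i) - g k (\<omega> i)\<bar> / n"
        by (simp add: sum_subtractf diff_divide_distrib[symmetric])
      also have "\<dots> \<le> (\<Sum>i<n. h (\<omega> i)) / n"
        unfolding h_def by (intro divide_right_mono sum_abs) auto
      finally show "\<eta> / 3 \<le> \<bar>(\<Sum>i<n. g k (\<omega> i)) / n - (\<integral>x. g k x \<partial>P)\<bar>"
        using A B mean \<open>\<kappa> \<le> \<eta> / 3\<close> by linarith
    qed
    then have "measure ?Q ?A \<le> measure ?Q (?B \<union> ?C)"
      by (intro Q.finite_measure_mono) measurable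
    also have "\<dots> \<le> measure ?Q ?B + measure ?Q ?C"
      by (intro measure_Un_le) measurable
    also have "measure ?Q ?B < e / 2"
      by (rule le_less_trans[OF Hoeffding_coordinates[where K="?K"] n0])
         (use assms n in \<open>auto intro: order_trans[OF g_le(2)]\<close>)
    also have "measure ?Q ?C \<le> (\<integral>\<omega>. (\<Sum>i<n. h (\<omega> i)) / n \<partial>?Q) / (\<eta> / 3)"
      by (rule integral_Markov_inequality_measure[where A="{}"])
         (use n h0 inthQ \<open>\<eta> > 0\<close> in \<open>auto intro!: AE_I2 sum_nonneg divide_nonneg_nonneg\<close>)
    also have "(\<integral>\<omega>. (\<Sum>i<n. h (\<omega> i)) / n \<partial>?Q) = (\<integral>x. h x \<partial>P)"
      using inthQ inthQ' n by simp
    also have "(\<integral>x. h x \<partial>P) / (\<eta> / 3) \<le> \<kappa> / (\<eta> / 3)"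
      using k \<open>\<eta> > 0\<close> by (intro divide_right_mono) (auto simp: h_def)
    also have "\<dots> \<le> (e * \<eta> / 12) / (\<eta> / 3)"
      using \<open>\<kappa> \<le> e * \<eta> / 12\<close> \<open>\<eta> > 0\<close> by (intro divide_right_mono) auto
    also have "\<dots> < e / 2" using \<open>\<eta> > 0\<close> \<open>e > 0\<close> by (simp add: field_simps)
    finally show "norm (measure ?Q ?A - 0) < e" by simp
  qed
qed

section \<open>Gaussian tail and central limit theorem\<close>

lemma std_normal_upper_tail:
  assumes "1 \<le> b"
  shows "std_normal_density b / (2 * b) \<le> measure std_normal_distribution {b..}"
proof -
  \<comment> \<open>\<open>F\<close> vanishes at infinity and its derivative \<open>f\<close> is at most the normal density on \<open>[1, \<infinity>)\<close>.\<close>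
  define F where "F x = - std_normal_density x / (2 * x)" for x :: real
  define f where "f x = std_normal_density x * (1 / 2 + 1 / (2 * x\<^sup>2))" for x :: real
  interpret N: real_distribution std_normal_distribution by (rule real_dist_normal_dist)
  have lim: "(F \<longlongrightarrow> 0) at_top"
  proof -
    have "F = (\<lambda>x. - (1 / sqrt (2 * pi) * exp (- x\<^sup>2 / 2)) / (2 * x))"
      by (simp add: F_def std_normal_density_def fun_eq_iff)
    moreover have "((\<lambda>x::real. - (1 / sqrt (2 * pi) * exp (- x\<^sup>2 / 2)) / (2 * x)) \<longlongrightarrow> 0) at_top"
      by real_asymp
    ultimately show ?thesis by simp
  qed
  have F': "DERIV F x :> f x" if "b \<le> x" for x
  proof -
    have "(std_normal_density has_real_derivative - x * std_normal_density x) (at x)"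
      unfolding std_normal_density_def
      by (rule derivative_eq_intros refl | simp)+
    then have "(F has_real_derivative
        ((- (- x * std_normal_density x)) * (2 * x) - (- std_normal_density x) * 2) / ((2 * x) * (2 * x))) (at x)"
      unfolding F_def using that assms by (intro DERIV_divide DERIV_minus DERIV_cmult_Id) auto
    moreover have "((- (- x * std_normal_density x)) * (2 * x) - (- std_normal_density x) * 2) / ((2 * x) * (2 * x)) = f x"
    proof -
      have "((- (- x * d)) * (2 * x) - (- d) * 2) / ((2 * x) * (2 * x)) = d * (1 / 2 + 1 / (2 * x\<^sup>2))" for d
        using that assms by (simp add: field_simps power2_eq_square)
      then show ?thesis unfolding f_def .
    qed
    ultimately show ?thesis by simp
  qed
  have "(\<integral>\<^sup>+x. ennreal (f x) * indicator {b..} x \<partial>lborel) = ennreal (0 - F b)"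
    by (rule nn_integral_FTC_atLeast[OF _ F' _ lim]) (auto simp: f_def)
  moreover have "(\<integral>\<^sup>+x. ennreal (f x) * indicator {b..} x \<partial>lborel)
      \<le> (\<integral>\<^sup>+x. ennreal (std_normal_density x) * indicator {b..} x \<partial>lborel)"
  proof (intro nn_integral_mono)
    fix x
    show "ennreal (f x) * indicator {b..} x \<le> ennreal (std_normal_density x) * indicator {b..} x"
    proof (cases "b \<le> x")
      case True
      then have "1 \<le> x\<^sup>2" using assms by (simp add: one_le_power)
      then have "1 / (2 * x\<^sup>2) \<le> 1 / 2" by (intro divide_left_mono) auto
      then have "1 / 2 + 1 / (2 * x\<^sup>2) \<le> 1" by linarith
      then have "f x \<le> std_normal_density x * 1"
        unfolding f_def by (intro mult_left_mono) auto
      then show ?thesis using True by (auto intro: ennreal_leI)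
    qed auto
  qed
  moreover have "\<dots> = emeasure std_normal_distribution {b..}"
    by (subst emeasure_density) auto
  ultimately have "ennreal (0 - F b) \<le> ennreal (measure std_normal_distribution {b..})"
    by (simp add: N.emeasure_eq_measure)
  then show ?thesis by (simp add: F_def)
qed

lemma measure_std_normal_singleton: "measure std_normal_distribution {b} = 0"
proof -
  have "emeasure std_normal_distribution {b} = 0"
    by (subst emeasure_density) (auto intro!: nn_integral_null_set simp: null_sets_def)
  then show ?thesis by (simp add: measure_def)
qed

text \<open>Weak convergence gives convergence of distribution functions at continuity points of the
  limit, and the normal law has no atoms, so every \<open>b\<close> qualifies. The variance enters
  the limit theorem as the square of a standard deviation, hence the detour through
  \<open>sqrt s\<close>.\<close>

lemma central_limit_upper:
  fixes f :: "'x \<Rightarrow> real" and s b :: real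
  assumes "prob_space P" and [measurable]: "f \<in> borel_measurable P"
    and "(\<integral>x. f x \<partial>P) = 0" and "integrable P (\<lambda>x. (f x)\<^sup>2)" and "(\<integral>x. (f x)\<^sup>2 \<partial>P) = s" and "s > 0"
  shows "(\<lambda>n. measure (PiM UNIV (\<lambda>_::nat. P))
     {\<omega> \<in> space (PiM UNIV (\<lambda>_::nat. P)). (\<Sum>i<n. f (\<omega> i)) / sqrt (n * s) \<le> b})
       \<longlonglongrightarrow> cdf std_normal_distribution b"
proof -
  let ?Q = "PiM UNIV (\<lambda>_::nat. P)"
  interpret Q: prob_space ?Q by (intro prob_space_PiM assms)
  interpret N: real_distribution std_normal_distribution by (rule real_dist_normal_dist)
  have [measurable]: "(\<lambda>\<omega>. f (\<omega> i)) \<in> borel_measurable ?Q" for i by measurable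
  have sq: "(\<lambda>x. (f x)\<^sup>2) \<in> borel_measurable P" by measurable
  have mean: "(\<integral>\<omega>. f (\<omega> i) \<partial>?Q) = 0" for i
    using integral_coordinate[OF assms(1,2), of i] assms(3) by simp
  have "weak_conv_m (\<lambda>n. distr ?Q borel (\<lambda>\<omega>. (\<Sum>i<n. f (\<omega> i)) / sqrt (n * (sqrt s)\<^sup>2)))
      std_normal_distribution"
  proof (rule Q.central_limit_theorem_zero_mean)
    show "Q.variance (\<lambda>\<omega>. f (\<omega> n)) = (sqrt s)\<^sup>2" for n
      using integral_coordinate[OF assms(1) sq, of n] assms(5,6) mean by simp
    show "integrable ?Q (\<lambda>\<omega>. (f (\<omega> n))\<^sup>2)" for n
      using integrable_coordinate[OF assms(1) sq, of n] assms(4) by simp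
    show "distr ?Q borel (\<lambda>\<omega>. f (\<omega> n)) = distr P borel f" for n
      by (rule distr_coordinate) fact+
  qed (use assms mean indep_vars_coordinates[OF assms(1,2)] in auto)
  moreover have "isCont (cdf std_normal_distribution) b"
    by (subst N.isCont_cdf) (rule measure_std_normal_singleton)
  ultimately have "(\<lambda>n. cdf (distr ?Q borel (\<lambda>\<omega>. (\<Sum>i<n. f (\<omega> i)) / sqrt (n * (sqrt s)\<^sup>2))) b)
       \<longlonglongrightarrow> cdf std_normal_distribution b"
    unfolding weak_conv_m_def weak_conv_def by blast
  also have "(\<lambda>n. cdf (distr ?Q borel (\<lambda>\<omega>. (\<Sum>i<n. f (\<omega> i)) / sqrt (n * (sqrt s)\<^sup>2))) b) =
    (\<lambda>n. measure ?Q {\<omega> \<in> space ?Q. (\<Sum>i<n. f (\<omega> i)) / sqrt (n * s) \<le> b})"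
    unfolding cdf_def using \<open>s > 0\<close>
    by (subst measure_distr) (auto intro!: ext arg_cong[where f="measure ?Q"])
  finally show ?thesis .
qed

text \<open>The tail bound concerns the closed half-line, while the distribution function is
  complementary to the open one; the singleton between them is null.\<close>

lemma cdf_std_normal_le:
  assumes "1 \<le> b"
  shows "cdf std_normal_distribution b \<le> 1 - std_normal_density b / (2 * b)"
proof -
  interpret N: real_distribution std_normal_distribution by (rule real_dist_normal_dist)
  note measure_std_normal_singleton[of b]
  moreover have "measure std_normal_distribution {b..} \<le> measure std_normal_distribution ({b} \<union> {b<..})"
    by (intro N.finite_measure_mono) auto
  moreover have "\<dots> \<le> measure std_normal_distribution {b} + measure std_normal_distribution {b<..}"
    by (intro measure_Un_le) auto
  moreover have "measure std_normal_distribution {b<..} = 1 - cdf std_normal_distribution b"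
    unfolding cdf_def using N.prob_compl[of "{..b}"] by (simp add: Compl_eq_Diff_UNIV[symmetric])
  ultimately show ?thesis using std_normal_upper_tail[OF assms] by linarith
qed

text \<open>Carries events about \<open>n\<close> outcomes to the infinite product, where the limit
  theorems live: the finite product is the image of the infinite one under restriction.\<close>

lemma measure_PiM_lessThan:
  assumes "prob_space P" and A: "A \<in> sets (PiM {..<n} (\<lambda>_. P))"
  shows "measure (PiM {..<n} (\<lambda>_. P)) A =
    measure (PiM UNIV (\<lambda>_::nat. P)) {\<omega> \<in> space (PiM UNIV (\<lambda>_. P)). restrict \<omega> {..<n} \<in> A}"
proof -
  interpret P: prob_space P by fact
  interpret R: product_prob_space "\<lambda>_::nat. P" UNIV by unfold_locales
  have "measure (PiM {..<n} (\<lambda>_. P)) A =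
      measure (distr (PiM UNIV (\<lambda>_. P)) (PiM {..<n} (\<lambda>_. P)) (\<lambda>x. restrict x {..<n})) A"
    by (subst R.distr_PiM_restrict_finite) auto
  also have "\<dots> = measure (PiM UNIV (\<lambda>_::nat. P)) {\<omega> \<in> space (PiM UNIV (\<lambda>_. P)). restrict \<omega> {..<n} \<in> A}"
    using A by (subst measure_distr) (auto intro!: arg_cong[where f="measure _"] measurable_restrict_subset)
  finally show ?thesis .
qed

section \<open>The Lambert function and the normal tail\<close>

lemma mult_exp_strict_mono:
  fixes v w :: real
  assumes "0 \<le> v" "v < w" shows "v * exp v < w * exp w"
  using assms by (intro mult_strict_mono) auto

text \<open>Existence is the intermediate value theorem on the interval from 0 to \<open>y\<close>.
  For uniqueness, a positive value of \<open>v * exp v\<close> forces \<open>v > 0\<close>, and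
  there the map is strictly increasing.\<close>

lemma lambert_W0_pos:
  assumes "y > 0"
  shows "lambert_W0 y > 0" "lambert_W0 y * exp (lambert_W0 y) = y"
proof -
  have "\<exists>w\<ge>0. w \<le> y \<and> w * exp w = y"
    using assms by (intro IVT') (auto intro!: continuous_intros)
  then obtain w where w: "w \<ge> 0" "w * exp w = y" by blast
  have "lambert_W0 y = w"
    unfolding lambert_W0_def
  proof (rule the_equality)
    fix v assume v: "- 1 \<le> v \<and> v * exp v = y"
    then have "v > 0" using assms by (metis exp_gt_zero zero_less_mult_pos2)
    then show "v = w" using mult_exp_strict_mono[of v w] mult_exp_strict_mono[of w v] v w
      by (cases v w rule: linorder_cases) auto
  qed (use w in auto)
  then show "lambert_W0 y > 0" "lambert_W0 y * exp (lambert_W0 y) = y"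
    using w assms by (auto simp: less_le)
qed

text \<open>The square of the tail bound is
  \<open>1 / (8 * pi * b\<^sup>2 * exp (b\<^sup>2))\<close>. Equating it with the square of
  \<open>\<delta>\<close> gives the Lambert equation for \<open>b\<^sup>2\<close>, which is where
  \<open>8 * pi\<close> comes from; a smaller \<open>b\<close> makes the tail bound larger than
  \<open>\<delta>\<close>.\<close>

lemma std_normal_density_lambert_W0:
  assumes "0 < \<delta>" "1 \<le> b" "b < sqrt (lambert_W0 (\<delta> powi (-2) / (8 * pi)))"
  shows "\<delta> < std_normal_density b / (2 * b)"
proof -
  define w where "w = lambert_W0 (\<delta> powi (-2) / (8 * pi))"
  have "\<delta> powi (-2) / (8 * pi) > 0" using assms by simp
  note w = lambert_W0_pos[OF this, folded w_def]
  have "b\<^sup>2 < (sqrt w)\<^sup>2" using assms by (intro power_strict_mono) (auto simp: w_def)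
  then have "b\<^sup>2 < w" using w by simp
  then have "b\<^sup>2 * exp (b\<^sup>2) < \<delta> powi (-2) / (8 * pi)"
    using mult_exp_strict_mono[of "b\<^sup>2" w] w by simp
  then have "\<delta>\<^sup>2 * (8 * pi * b\<^sup>2 * exp (b\<^sup>2)) < 1"
    using assms by (simp add: field_simps power_int_minus)
  moreover have "(std_normal_density b / (2 * b))\<^sup>2 = 1 / (8 * pi * b\<^sup>2 * exp (b\<^sup>2))"
  proof -
    have "(exp (- b\<^sup>2 / 2))\<^sup>2 = 1 / exp (b\<^sup>2)"
      by (simp add: exp_minus field_simps flip: exp_double)
    then show ?thesis
      unfolding std_normal_density_def power_mult_distrib power_divide by simp
  qed
  moreover have "0 < 8 * pi * b\<^sup>2 * exp (b\<^sup>2)" using assms by simp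
  ultimately have "\<delta>\<^sup>2 < (std_normal_density b / (2 * b))\<^sup>2"
    by (metis pos_less_divide_eq)
  then show ?thesis using assms by (intro power_less_imp_less_base[of \<delta> 2]) auto
qed

text \<open>At the threshold for \<open>\<delta>\<close> the argument of the Lambert function is
  \<open>exp 1\<close>, where its value is 1. Exceeding 1 leaves room for a \<open>b \<ge> 1\<close>
  below the square root of the Lambert value, as the tail bound requires.\<close>

lemma lambert_W0_gt_1:
  assumes "0 < \<delta>" "\<delta> < 1 / sqrt (8 * pi * exp 1)"
  shows "1 < lambert_W0 (\<delta> powi (-2) / (8 * pi))"
proof (rule ccontr)
  define w where "w = lambert_W0 (\<delta> powi (-2) / (8 * pi))"
  have "\<delta> powi (-2) / (8 * pi) > 0" using assms by simp
  note w = lambert_W0_pos[OF this, folded w_def]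
  assume "\<not> 1 < lambert_W0 (\<delta> powi (-2) / (8 * pi))"
  then have "w * exp w \<le> 1 * exp 1" using w by (intro mult_mono) (auto simp: w_def)
  then have "1 \<le> exp 1 * (8 * pi) * \<delta>\<^sup>2" using w assms by (simp add: field_simps power_int_minus)
  moreover have "\<delta>\<^sup>2 < (1 / sqrt (8 * pi * exp 1))\<^sup>2" using assms by (intro power_strict_mono) auto
  ultimately show False by (simp add: power_divide field_simps)
qed

section \<open>The largest eigenvalue of a symmetric matrix\<close>

text \<open>First-order condition at the minimum \<open>t = 0\<close>. If \<open>a\<close> were
  nonzero, then at \<open>t = - a / k\<close> with a positive \<open>k > b\<close> the linear term
  would outweigh the quadratic one.\<close>

lemma linear_coeff_eq_0:
  fixes a b :: real
  assumes "\<And>t. 0 \<le> a * t + b * t\<^sup>2"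
  shows "a = 0"
proof (rule ccontr)
  assume "a \<noteq> 0"
  define k where "k = \<bar>b\<bar> + 1"
  have "k > 0" "b < k" by (auto simp: k_def)
  have "0 \<le> a * (- a / k) + b * (- a / k)\<^sup>2" by (rule assms)
  also have "\<dots> = a\<^sup>2 * (b - k) / k\<^sup>2" using \<open>k > 0\<close> by (simp add: field_simps power2_eq_square)
  also have "\<dots> < 0" using \<open>k > 0\<close> \<open>b < k\<close> \<open>a \<noteq> 0\<close> by (simp add: divide_neg_pos mult_pos_neg)
  finally show False by simp
qed

text \<open>Variational characterization: a maximizer of the quadratic form on the unit sphere is an
  eigenvector for the largest eigenvalue.\<close>

lemma mu_max_symmetric:
  fixes A :: "real^'n^('n::finite)"
  assumes sym: "transpose A = A"
  obtains v where "norm v = 1" "A *v v = mu_max A *\<^sub>R v"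
proof -
  define q where "q v = v \<bullet> (A *v v)" for v
  have "continuous_on (sphere 0 1) q" unfolding q_def by (intro continuous_intros)
  moreover have "sphere (0::real^'n) 1 \<noteq> {}" by simp
  ultimately obtain v where v: "v \<in> sphere 0 1" and max: "\<And>y. y \<in> sphere 0 1 \<Longrightarrow> q y \<le> q v"
    using continuous_attains_sup[OF compact_sphere] by metis
  define \<mu> where "\<mu> = q v"
  have nv: "norm v = 1" using v by simp
  \<comment> \<open>Both sides are homogeneous of degree 2, so the maximum on the sphere controls
    all vectors.\<close>
  have le: "q y \<le> \<mu> * (y \<bullet> y)" for y
  proof (cases "y = 0")
    case False
    have "q ((1 / norm y) *\<^sub>R y) \<le> \<mu>" unfolding \<mu>_def using False by (intro max) simp
    moreover have "q ((1 / norm y) *\<^sub>R y) = q y / (y \<bullet> y)"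
      by (simp add: q_def matrix_vector_mult_scaleR dot_square_norm power2_eq_square)
    ultimately show ?thesis using False by (simp add: field_simps)
  qed (simp add: q_def)
  \<comment> \<open>Along \<open>v + t *\<^sub>R y\<close> the gap in the preceding inequality is a
    nonnegative quadratic in \<open>t\<close> that vanishes at 0. Its linear coefficient must
    therefore vanish, and by symmetry of \<open>A\<close> it is twice this inner product.\<close>
  have "y \<bullet> (\<mu> *\<^sub>R v - A *v v) = 0" for y
  proof -
    have symq: "v \<bullet> (A *v y) = y \<bullet> (A *v v)"
      using dot_lmul_matrix[of v A y] vector_transpose_matrix[of v A] sym
      by (metis inner_commute)
    have "2 * (y \<bullet> (\<mu> *\<^sub>R v - A *v v)) = 0"
    proof (rule linear_coeff_eq_0)
      fix t
      have "0 \<le> \<mu> * ((v + t *\<^sub>R y) \<bullet> (v + t *\<^sub>R y)) - q (v + t *\<^sub>R y)" using le by simp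
      also have "\<dots> = (\<mu> * (v \<bullet> v) - q v) + 2 * (y \<bullet> (\<mu> *\<^sub>R v - A *v v)) * t + (\<mu> * (y \<bullet> y) - q y) * t\<^sup>2"
        unfolding q_def using symq
        by (simp add: algebra_simps matrix_vector_mult_scaleR power2_eq_square inner_commute[of v y])
      also have "\<mu> * (v \<bullet> v) - q v = 0" using nv by (simp add: \<mu>_def dot_square_norm)
      finally show "0 \<le> 2 * (y \<bullet> (\<mu> *\<^sub>R v - A *v v)) * t + (\<mu> * (y \<bullet> y) - q y) * t\<^sup>2" by simp
    qed
    then show ?thesis by simp
  qed
  then have ev: "A *v v = \<mu> *\<^sub>R v" by (metis inner_eq_zero_iff eq_iff_diff_eq_0)
  have "mu_max A = \<mu>" unfolding mu_max_def
  proof (rule Greatest_equality)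
    show "matrix_eigenvalue A \<mu>" unfolding matrix_eigenvalue_def using ev nv by (intro exI[of _ v]) auto
    fix l assume "matrix_eigenvalue A l"
    then obtain y where y: "y \<noteq> 0" "A *v y = l *\<^sub>R y" by (auto simp: matrix_eigenvalue_def)
    then have "l * (y \<bullet> y) \<le> \<mu> * (y \<bullet> y)" using le[of y] by (simp add: q_def)
    then show "l \<le> \<mu>" using y by simp
  qed
  with ev nv that show ?thesis by blast
qed

lemma mu_max_le_onorm:
  fixes A :: "real^'n^('n::finite)"
  assumes "transpose A = A"
  shows "mu_max A \<le> onorm ((*v) A)"
proof -
  obtain v where v: "norm v = 1" "A *v v = mu_max A *\<^sub>R v" using mu_max_symmetric[OF assms] .
  have "mu_max A \<le> norm (A *v v)" using v by simp
  also have "\<dots> \<le> onorm ((*v) A) * norm v" by (intro onorm matrix_vector_mul_bounded_linear)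
  finally show ?thesis using v by simp
qed

section \<open>Taylor expansion of the score\<close>

lemma has_derivative_partial_deriv:
  fixes f :: "real^'n::finite \<Rightarrow> real"
  assumes "(f has_derivative D) (at x)"
  shows "D h = (\<Sum>i\<in>UNIV. h $ i * partial_deriv i f x)"
proof -
  interpret D: bounded_linear D using assms by (rule has_derivative_bounded_linear)
  have "partial_deriv i f x = D (axis i 1)" for i
  proof -
    have "((\<lambda>t::real. x + t *\<^sub>R axis i 1) has_derivative (\<lambda>t. t *\<^sub>R axis i 1)) (at 0)"
      by (auto intro!: derivative_eq_intros)
    then have "((\<lambda>t. f (x + t *\<^sub>R axis i 1)) has_derivative (\<lambda>t. D (t *\<^sub>R axis i 1))) (at 0)"
      by (rule has_derivative_compose) (use assms in simp)
    then have "((\<lambda>t. f (x + t *\<^sub>R axis i 1)) has_real_derivative D (axis i 1)) (at 0)"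
      by (rule has_derivative_imp_has_field_derivative) (simp add: D.scaleR)
    then show ?thesis unfolding partial_deriv_def by (rule DERIV_imp_deriv)
  qed
  moreover have "D h = D (\<Sum>i\<in>UNIV. h $ i *\<^sub>R axis i 1)" using basis_expansion[of h] by (simp add: scalar_mult_eq_scaleR)
  ultimately show ?thesis by (simp add: D.sum D.scaleR)
qed

lemma DERIV_along_line:
  fixes f :: "real^'n::finite \<Rightarrow> real"
  assumes "f differentiable (at (x + t *\<^sub>R h))"
  shows "((\<lambda>t. f (x + t *\<^sub>R h)) has_real_derivative
           (\<Sum>i\<in>UNIV. h $ i * partial_deriv i f (x + t *\<^sub>R h))) (at t)"
proof -
  obtain D where D: "(f has_derivative D) (at (x + t *\<^sub>R h))" using assms by (auto simp: differentiable_def)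
  interpret D: bounded_linear D using D by (rule has_derivative_bounded_linear)
  have "((\<lambda>t::real. x + t *\<^sub>R h) has_derivative (\<lambda>s. s *\<^sub>R h)) (at t)"
    by (auto intro!: derivative_eq_intros)
  then have "((\<lambda>t. f (x + t *\<^sub>R h)) has_derivative (\<lambda>s. D (s *\<^sub>R h))) (at t)"
    by (rule has_derivative_compose) (use D in simp)
  then have "((\<lambda>t. f (x + t *\<^sub>R h)) has_real_derivative D h) (at t)"
    by (rule has_derivative_imp_has_field_derivative) (simp add: D.scaleR)
  then show ?thesis by (simp add: has_derivative_partial_deriv[OF D])
qed

lemma Ck_on_3D:
  assumes "Ck_on 3 S f"
  shows "f differentiable_on S" "partial_deriv i f differentiable_on S"
    "partial_deriv j (partial_deriv i f) differentiable_on S"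
    "continuous_on S (partial_deriv k (partial_deriv j (partial_deriv i f)))"
  using assms by (auto simp: numeral_3_eq_3)

text \<open>Second-order expansion of the directional score along the segment from
  \<open>\<theta>\<close> to \<open>\<theta> + h\<close>. Entrywise bounds suffice for the remainder
  because components of \<open>u\<close> are at most 1 and those of \<open>h\<close> at most
  \<open>\<epsilon>\<close> in absolute value. The indices of \<open>B\<close> are reversed since
  the gradient index \<open>i\<close> belongs to the innermost derivative.\<close>

lemma score_taylor:
  fixes f :: "real^'n::finite \<Rightarrow> real"
  assumes "open S" "Ck_on 3 S f" "cball \<theta> \<epsilon> \<subseteq> S" "norm u = 1" "norm h \<le> \<epsilon>"
    and B: "\<And>i j k y. y \<in> cball \<theta> \<epsilon> \<Longrightarrow> \<bar>third_deriv f y $ i $ j $ k\<bar> \<le> B i j k"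
  shows "\<bar>u \<bullet> grad f (\<theta> + h) - u \<bullet> grad f \<theta> - (\<Sum>i\<in>UNIV. u $ i * (\<Sum>j\<in>UNIV. h $ j * hess f \<theta> $ j $ i))\<bar>
    \<le> \<epsilon>\<^sup>2 * (\<Sum>i\<in>UNIV. \<Sum>j\<in>UNIV. \<Sum>k\<in>UNIV. B k j i)"
proof -
  define \<phi> where "\<phi> t = (\<Sum>i\<in>UNIV. u $ i * partial_deriv i f (\<theta> + t *\<^sub>R h))" for t
  define \<phi>1 where "\<phi>1 t = (\<Sum>i\<in>UNIV. u $ i * (\<Sum>j\<in>UNIV. h $ j * partial_deriv j (partial_deriv i f) (\<theta> + t *\<^sub>R h)))" for t
  define \<phi>2 where "\<phi>2 t = (\<Sum>i\<in>UNIV. u $ i * (\<Sum>j\<in>UNIV. h $ j *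
     (\<Sum>k\<in>UNIV. h $ k * partial_deriv k (partial_deriv j (partial_deriv i f)) (\<theta> + t *\<^sub>R h))))" for t
  have in_ball: "\<theta> + t *\<^sub>R h \<in> cball \<theta> \<epsilon>" if "0 \<le> t" "t \<le> 1" for t
  proof -
    have "t * norm h \<le> 1 * norm h" using that by (intro mult_right_mono) auto
    then show ?thesis using that assms(5) by (simp add: dist_norm)
  qed
  have diff: "g differentiable (at (\<theta> + t *\<^sub>R h))" if "0 \<le> t" "t \<le> 1" "g differentiable_on S" for t and g :: "real^'n \<Rightarrow> real"
    using that in_ball assms(1,3) by (metis at_within_open differentiable_on_def subset_iff)
  have 1: "(\<phi> has_real_derivative \<phi>1 t) (at t)" if "0 \<le> t" "t \<le> 1" for t
    unfolding \<phi>_def \<phi>1_def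
    by (intro DERIV_sum DERIV_cmult DERIV_along_line diff that Ck_on_3D[OF assms(2)])
  have 2: "(\<phi>1 has_real_derivative \<phi>2 t) (at t)" if "0 \<le> t" "t \<le> 1" for t
    unfolding \<phi>1_def \<phi>2_def
    by (intro DERIV_sum DERIV_cmult DERIV_along_line diff that Ck_on_3D[OF assms(2)])
  \<comment> \<open>Two applications of the mean value theorem give the remainder
    \<open>s * \<phi>2 r\<close> with \<open>s < 1\<close>. The missing factor 1/2 costs nothing,
    since the remainder enters only through its order in \<open>\<epsilon>\<close>.\<close>
  obtain s where s: "0 < s" "s < 1" "\<phi> 1 - \<phi> 0 = (1 - 0) * \<phi>1 s"
    using MVT2[of 0 1 \<phi> \<phi>1] 1 by auto
  obtain r where r: "0 < r" "r < s" "\<phi>1 s - \<phi>1 0 = (s - 0) * \<phi>2 r"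
    using MVT2[of 0 s \<phi>1 \<phi>2] 2 s by auto
  have "\<epsilon> \<ge> 0" using assms(5) norm_ge_zero order_trans by blast
  have "\<bar>\<phi>2 r\<bar> \<le> (\<Sum>i\<in>UNIV. 1 * (\<Sum>j\<in>UNIV. \<epsilon> * (\<Sum>k\<in>UNIV. \<epsilon> * B k j i)))"
    unfolding \<phi>2_def
  proof (intro order_trans[OF sum_abs] sum_mono order_trans[OF eq_refl[OF abs_mult]] mult_mono)
    show "\<bar>u $ i\<bar> \<le> 1" for i using component_le_norm_cart[of u i] assms(4) by simp
    show "\<bar>h $ i\<bar> \<le> \<epsilon>" "\<bar>h $ i\<bar> \<le> \<epsilon>" for i using component_le_norm_cart[of h i] assms(5) by auto
    show "\<bar>partial_deriv k (partial_deriv j (partial_deriv i f)) (\<theta> + r *\<^sub>R h)\<bar> \<le> B k j i" for i j k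
      using B[OF in_ball[of r], of k j i] r s by (simp add: third_deriv_def)
  qed (use \<open>\<epsilon> \<ge> 0\<close> in auto)
  also have "\<dots> = \<epsilon>\<^sup>2 * (\<Sum>i\<in>UNIV. \<Sum>j\<in>UNIV. \<Sum>k\<in>UNIV. B k j i)"
    by (simp add: sum_distrib_left power2_eq_square mult_ac)
  finally have "\<bar>\<phi>2 r\<bar> \<le> \<epsilon>\<^sup>2 * (\<Sum>i\<in>UNIV. \<Sum>j\<in>UNIV. \<Sum>k\<in>UNIV. B k j i)" .
  moreover have "\<bar>s * \<phi>2 r\<bar> \<le> 1 * \<bar>\<phi>2 r\<bar>"
    unfolding abs_mult using s by (intro mult_right_mono) auto
  moreover have "\<phi> 1 = u \<bullet> grad f (\<theta> + h)" "\<phi> 0 = u \<bullet> grad f \<theta>"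
    "\<phi>1 0 = (\<Sum>i\<in>UNIV. u $ i * (\<Sum>j\<in>UNIV. h $ j * hess f \<theta> $ j $ i))"
    by (simp_all add: \<phi>_def \<phi>1_def grad_def hess_def inner_vec_def)
  ultimately show ?thesis using s(3) r(3) by simp
qed

text \<open>A partial derivative is a pointwise limit of difference quotients along one fixed
  sequence of steps, and each quotient is measurable in the outcome.\<close>

lemma borel_measurable_partial_deriv:
  fixes f :: "real^'n::finite \<Rightarrow> 'x \<Rightarrow> real"
  assumes "open S" "\<theta> \<in> S"
    and [measurable]: "\<And>\<theta>. \<theta> \<in> S \<Longrightarrow> f \<theta> \<in> borel_measurable \<nu>"
    and diff: "\<And>x. x \<in> space \<nu> \<Longrightarrow> (\<lambda>\<theta>. f \<theta> x) differentiable_on S"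
  shows "(\<lambda>x. partial_deriv i (\<lambda>\<theta>. f \<theta> x) \<theta>) \<in> borel_measurable \<nu>"
proof -
  obtain e where e: "e > 0" "ball \<theta> e \<subseteq> S" using assms(1,2) by (meson open_contains_ball)
  \<comment> \<open>Shifting the index by \<open>N\<close> keeps every step below \<open>e\<close>,
    so all shifted parameters stay in \<open>S\<close>.\<close>
  obtain N :: nat where N: "1 / e < N" using reals_Archimedean2 by blast
  then have "N > 0" using e by (metis divide_pos_pos less_numeral_extra(1) of_nat_0_less_iff order_less_trans)
  define s where "s k = 1 / real (k + N)" for k
  have s: "0 < s k" "s k < e" for k
  proof -
    show "0 < s k" using \<open>N > 0\<close> by (simp add: s_def)
    have "1 / e < real (k + N)" using N by simp
    then show "s k < e" using e \<open>N > 0\<close> by (simp add: s_def field_simps)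
  qed
  have s0: "s \<longlonglongrightarrow> 0"
    unfolding s_def by real_asymp
  have inS: "\<theta> + s k *\<^sub>R axis i 1 \<in> S" for k
    using s[of k] e by (intro subsetD[OF e(2)]) (simp add: dist_norm)
  show ?thesis
  proof (rule borel_measurable_LIMSEQ_real)
    show "(\<lambda>x. (f (\<theta> + s k *\<^sub>R axis i 1) x - f \<theta> x) / s k) \<in> borel_measurable \<nu>" for k
      using inS assms(2) by measurable
    fix x assume x: "x \<in> space \<nu>"
    have "(\<lambda>\<theta>. f \<theta> x) differentiable (at \<theta>)"
      using diff[OF x] assms(1,2) by (metis at_within_open differentiable_on_def)
    then have "(\<lambda>\<theta>. f \<theta> x) differentiable (at (\<theta> + 0 *\<^sub>R axis i 1))" by simp
    then obtain D where D: "((\<lambda>t. f (\<theta> + t *\<^sub>R axis i 1) x) has_real_derivative D) (at 0)"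
      using DERIV_along_line by blast
    moreover have "partial_deriv i (\<lambda>\<theta>. f \<theta> x) \<theta> = D"
      unfolding partial_deriv_def by (rule DERIV_imp_deriv[OF D])
    ultimately have "((\<lambda>t. f (\<theta> + t *\<^sub>R axis i 1) x) has_real_derivative partial_deriv i (\<lambda>\<theta>. f \<theta> x) \<theta>) (at 0)"
      by simp
    then have "((\<lambda>t. (f (\<theta> + t *\<^sub>R axis i 1) x - f \<theta> x) / t) \<longlongrightarrow> partial_deriv i (\<lambda>\<theta>. f \<theta> x) \<theta>) (at 0)"
      by (simp add: DERIV_def)
    moreover have "filterlim s (at 0) sequentially"
      using s0 s(1) by (auto simp: filterlim_at intro!: always_eventually less_imp_neq[THEN not_sym])
    ultimately show "(\<lambda>k. (f (\<theta> + s k *\<^sub>R axis i 1) x - f \<theta> x) / s k) \<longlonglongrightarrow> partial_deriv i (\<lambda>\<theta>. f \<theta> x) \<theta>"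
      by (rule filterlim_compose)
  qed
qed

text \<open>The entry is the value of the trilinear form at three axis vectors. Boundedness over the
  unit spheres has to be shown first, for the real supremum to be an upper bound.\<close>

lemma abs_component_le_tensor_opnorm: "\<bar>T $ i $ j $ k\<bar> \<le> tensor_opnorm T"
proof -
  let ?F = "\<lambda>(u, v, w). \<bar>\<Sum>i\<in>UNIV. \<Sum>j\<in>UNIV. \<Sum>k\<in>UNIV. T $ i $ j $ k * u $ i * v $ j * w $ k\<bar>"
  have "bdd_above (?F ` (sphere 0 1 \<times> sphere 0 1 \<times> sphere 0 1))"
  proof (rule bdd_aboveI2)
    fix z :: "(real^'a) \<times> (real^'a) \<times> (real^'a)" assume z: "z \<in> sphere 0 1 \<times> sphere 0 1 \<times> sphere 0 1"
    obtain u v w where [simp]: "z = (u, v, w)" by (cases z)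
    have le: "\<bar>u $ i\<bar> \<le> 1" "\<bar>v $ i\<bar> \<le> 1" "\<bar>w $ i\<bar> \<le> 1" for i
      using z component_le_norm_cart[of u i] component_le_norm_cart[of v i] component_le_norm_cart[of w i] by auto
    have "\<bar>T $ i $ j $ k\<bar> * \<bar>u $ i\<bar> * \<bar>v $ j\<bar> * \<bar>w $ k\<bar> \<le> \<bar>T $ i $ j $ k\<bar> * 1 * 1 * 1" for i j k
      by (intro mult_mono le order_refl) auto
    then show "?F z \<le> (\<Sum>i\<in>UNIV. \<Sum>j\<in>UNIV. \<Sum>k\<in>UNIV. \<bar>T $ i $ j $ k\<bar>)"
      by (auto intro!: order_trans[OF sum_abs] sum_mono simp: abs_mult)
  qed
  moreover have "(axis i 1, axis j 1, axis k 1) \<in> sphere (0::real^'a) 1 \<times> sphere (0::real^'a) 1 \<times> sphere (0::real^'a) 1"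
    by simp
  ultimately have "?F (axis i 1, axis j 1, axis k 1) \<le> tensor_opnorm T"
    unfolding tensor_opnorm_def by (intro cSUP_upper)
  moreover have "?F (axis i 1, axis j 1, axis k 1) = \<bar>T $ i $ j $ k\<bar>"
    by (simp add: axis_def if_distrib[of "\<lambda>x. _ * x"] sum.delta cong: if_cong)
  ultimately show ?thesis by simp
qed

section \<open>Maximum-likelihood estimation\<close>

lemma space_outcome_law [simp]: "space (outcome_law \<nu> p \<theta>) = space \<nu>"
  and sets_outcome_law [measurable_cong, simp]: "sets (outcome_law \<nu> p \<theta>) = sets \<nu>"
  by (simp_all add: outcome_law_def)

text \<open>Smoothness is assumed for samples; samples of size one bring it down to single
  outcomes.\<close>

lemma Ck_on_loglik:
  assumes "A2 \<nu> p \<Theta>a" "x \<in> space \<nu>"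
  shows "Ck_on 3 \<Theta>a (loglik p x)"
proof -
  define xs where "xs = (\<lambda>i\<in>{..<1::nat}. x)"
  have "xs \<in> space (PiM {..<1} (\<lambda>_. \<nu>))" using assms(2) by (auto simp: xs_def space_PiM)
  then have "Ck_on 3 \<Theta>a (sample_loglik p 1 xs)" using assms(1) unfolding A2_def by blast
  moreover have "sample_loglik p 1 xs = loglik p x"
    by (simp add: sample_loglik_def xs_def fun_eq_iff)
  ultimately show ?thesis by simp
qed

text \<open>Supplies bounds near \<open>\<theta>\<close> to which the law of large numbers applies.
  Each entry is dominated by the operator norm, so the second moment in \<open>R4\<close> controls
  that of \<open>G\<close>.\<close>

lemma third_deriv_envelope:
  fixes p :: "real^'n::finite \<Rightarrow> 'x \<Rightarrow> real"
  assumes model: "statistical_model \<nu> p \<Theta> \<Theta>a" and A2: "A2 \<nu> p \<Theta>a"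
    and R1: "R1 \<Theta> \<Theta>a r0" and R4: "R4 \<nu> p \<Theta> r0" and \<theta>: "\<theta> \<in> \<Theta>"
  obtains G where "\<And>i j k. integrable (outcome_law \<nu> p \<theta>) (G i j k)"
    "\<And>i j k x y. x \<in> space \<nu> \<Longrightarrow> y \<in> cball \<theta> r0 \<Longrightarrow>
       \<bar>third_deriv (loglik p x) y $ i $ j $ k\<bar> \<le> G i j k x"
proof -
  let ?P = "outcome_law \<nu> p \<theta>"
  interpret P: prob_space ?P using model \<theta> by (auto simp: statistical_model_def)
  have op: "open \<Theta>a" using model by (auto simp: statistical_model_def)
  have r0: "r0 > 0" and sub: "cball \<theta> r0 \<subseteq> \<Theta>a"
  proof -
    show "r0 > 0" using R1 by (simp add: R1_def)
    show "cball \<theta> r0 \<subseteq> \<Theta>a"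
    proof
      fix y assume "y \<in> cball \<theta> r0"
      then have "norm (y - \<theta>) \<le> r0" by (simp add: dist_norm norm_minus_commute)
      then have "\<theta> + (y - \<theta>) \<in> \<Theta>a" using R1 \<theta> unfolding R1_def by blast
      then show "y \<in> \<Theta>a" by simp
    qed
  qed
  define T where "T i j k x y = third_deriv (loglik p x) y $ i $ j $ k" for i j k x y
  have T_eq: "T i j k x y = partial_deriv i (partial_deriv j (partial_deriv k (loglik p x))) y" for i j k x y
    by (simp add: T_def third_deriv_def)
  have cont: "continuous_on (cball \<theta> r0) (T i j k x)" if "x \<in> space \<nu>" for i j k x
    unfolding T_eq using Ck_on_3D(4)[OF Ck_on_loglik[OF A2 that]] sub by (rule continuous_on_subset)
  have meas: "(\<lambda>x. T i j k x y) \<in> borel_measurable \<nu>" if "y \<in> \<Theta>a" for i j k y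
  proof -
    have 0: "(\<lambda>x. loglik p x y) \<in> borel_measurable \<nu>" if "y \<in> \<Theta>a" for y
      unfolding loglik_def using model that by (intro borel_measurable_ln) (auto simp: statistical_model_def)
    have 1: "(\<lambda>x. partial_deriv k (loglik p x) y) \<in> borel_measurable \<nu>" if "y \<in> \<Theta>a" for y k
      using borel_measurable_partial_deriv[OF op that, of "\<lambda>y x. loglik p x y"] 0 Ck_on_3D(1)[OF Ck_on_loglik[OF A2]] by simp
    have 2: "(\<lambda>x. partial_deriv j (partial_deriv k (loglik p x)) y) \<in> borel_measurable \<nu>" if "y \<in> \<Theta>a" for y j k
      using borel_measurable_partial_deriv[OF op that, of "\<lambda>y x. partial_deriv k (loglik p x) y"] 1 Ck_on_3D(2)[OF Ck_on_loglik[OF A2]] by simp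
    show ?thesis unfolding T_eq
      using borel_measurable_partial_deriv[OF op that, of "\<lambda>y x. partial_deriv j (partial_deriv k (loglik p x)) y"] 2 Ck_on_3D(3)[OF Ck_on_loglik[OF A2]] by simp
  qed
  obtain D where D: "countable D" "D \<subseteq> cball \<theta> r0" "cball \<theta> r0 \<subseteq> closure D"
    using separable by blast
  have "D \<noteq> {}" using D(3) r0 by auto
  \<comment> \<open>The supremum runs over a countable set, so that \<open>G\<close> is measurable; by continuity it still
    dominates the third derivatives on the whole ball.\<close>
  define G where "G i j k x = (SUP y\<in>D. \<bar>T i j k x y\<bar>)" for i j k x
  have bdd: "bdd_above ((\<lambda>y. \<bar>T i j k x y\<bar>) ` D)" if "x \<in> space \<nu>" for i j k x
  proof -
    have "compact ((\<lambda>y. \<bar>T i j k x y\<bar>) ` cball \<theta> r0)"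
      by (intro compact_continuous_image continuous_intros cont that) auto
    then have "bdd_above ((\<lambda>y. \<bar>T i j k x y\<bar>) ` cball \<theta> r0)"
      by (intro bounded_imp_bdd_above compact_imp_bounded)
    then show ?thesis by (rule bdd_above_mono) (use D(2) in auto)
  qed
  have le: "\<bar>T i j k x y\<bar> \<le> G i j k x" if "x \<in> space \<nu>" "y \<in> cball \<theta> r0" for i j k x y
  proof -
    have "closure D = cball \<theta> r0" using D closure_minimal[OF D(2)] by auto
    then have "continuous_on (closure D) (\<lambda>y. \<bar>T i j k x y\<bar>)" using cont[OF that(1)] by (auto intro: continuous_intros)
    then show ?thesis
      by (rule continuous_le_on_closure) (use D that bdd in \<open>auto simp: G_def intro: cSUP_upper\<close>)
  qed
  have G0: "0 \<le> G i j k x" if "x \<in> space \<nu>" for i j k x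
    using le[OF that, of \<theta> i j k] r0 by auto
  have Gm: "G i j k \<in> borel_measurable \<nu>" for i j k
    unfolding G_def using D meas sub by (intro borel_measurable_cSUP bdd borel_measurable_abs) auto
  have sup: "ennreal (G i j k x) \<le> (SUP \<Delta>\<in>cball 0 r0. ennreal (tensor_opnorm (third_deriv (loglik p x) (\<theta> + \<Delta>))))"
    (is "_ \<le> ?R") for i j k x
  proof (cases "?R = \<infinity>")
    case False
    then obtain r where r: "r \<ge> 0" "?R = ennreal r" by (cases ?R) auto
    have "\<bar>T i j k x y\<bar> \<le> r" if "y \<in> D" for y
    proof -
      have "y - \<theta> \<in> cball 0 r0" using that D(2) by (auto simp: dist_norm norm_minus_commute)
      then have "ennreal (tensor_opnorm (third_deriv (loglik p x) (\<theta> + (y - \<theta>)))) \<le> ennreal r"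
        unfolding r(2)[symmetric] by (rule SUP_upper)
      then have "tensor_opnorm (third_deriv (loglik p x) y) \<le> r" using r(1) by simp
      then show ?thesis unfolding T_def using abs_component_le_tensor_opnorm order_trans by blast
    qed
    then have "G i j k x \<le> r" unfolding G_def using \<open>D \<noteq> {}\<close> by (intro cSUP_least) auto
    then show ?thesis unfolding r(2) by (rule ennreal_leI)
  next
    case True
    show ?thesis unfolding True by simp
  qed
  have "integrable ?P (G i j k)" for i j k
  proof (rule integrableI_bounded)
    show m: "G i j k \<in> borel_measurable ?P" using Gm by (simp cong: measurable_cong_sets)
    have "(\<integral>\<^sup>+x. (ennreal (G i j k x))\<^sup>2 \<partial>?P) \<le>
       (\<integral>\<^sup>+x. (SUP \<Delta>\<in>cball 0 r0. ennreal (tensor_opnorm (third_deriv (loglik p x) (\<theta> + \<Delta>))))\<^sup>2 \<partial>?P)"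
      by (intro nn_integral_mono power_mono sup) auto
    also have "\<dots> < \<infinity>"
      using R4 unfolding R4_def by (rule le_less_trans[OF SUP_upper[OF \<theta>]])
    finally have fin: "(\<integral>\<^sup>+x. (ennreal (G i j k x))\<^sup>2 \<partial>?P) < \<infinity>" .
    \<comment> \<open>On a probability space a finite second moment yields a finite first moment,
      here through \<open>g \<le> 1 + g\<^sup>2\<close>.\<close>
    have "(\<integral>\<^sup>+x. ennreal (norm (G i j k x)) \<partial>?P) \<le> (\<integral>\<^sup>+x. 1 + (ennreal (G i j k x))\<^sup>2 \<partial>?P)"
    proof (rule nn_integral_mono)
      fix x assume "x \<in> space ?P"
      then have g: "0 \<le> G i j k x" using G0 by simp
      have "2 * G i j k x \<le> 1 + (G i j k x)\<^sup>2"
        using zero_le_power2[of "G i j k x - 1"] by (simp add: power2_diff)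
      then have "G i j k x \<le> 1 + (G i j k x)\<^sup>2" using g by linarith
      then have "ennreal (norm (G i j k x)) \<le> ennreal (1 + (G i j k x)\<^sup>2)" using g by (intro ennreal_leI) simp
      also have "\<dots> = 1 + (ennreal (G i j k x))\<^sup>2" using g by (simp add: ennreal_power)
      finally show "ennreal (norm (G i j k x)) \<le> 1 + (ennreal (G i j k x))\<^sup>2" .
    qed
    also have "\<dots> = 1 + (\<integral>\<^sup>+x. (ennreal (G i j k x))\<^sup>2 \<partial>?P)"
      using m by (subst nn_integral_add) (auto simp: P.emeasure_space_1[simplified])
    also have "\<dots> < \<infinity>" using fin by (simp add: ennreal_add_less_top)
    finally show "(\<integral>\<^sup>+x. ennreal (norm (G i j k x)) \<partial>?P) < \<infinity>" .
  qed
  then show ?thesis using le unfolding T_def by (intro that[of G]) auto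
qed

section \<open>The likelihood equation and its expansion at the true parameter\<close>

lemma grad_sample_loglik:
  fixes p :: "real^'n::finite \<Rightarrow> 'x \<Rightarrow> real"
  assumes "open S" "\<theta> \<in> S" "\<And>m. m < M \<Longrightarrow> loglik p (xs m) differentiable_on S"
  shows "grad (sample_loglik p M xs) \<theta> = (\<Sum>m<M. grad (loglik p (xs m)) \<theta>)"
proof -
  have "partial_deriv i (sample_loglik p M xs) \<theta> = (\<Sum>m<M. partial_deriv i (loglik p (xs m)) \<theta>)" for i
    unfolding partial_deriv_def[of i "sample_loglik p M xs"] sample_loglik_def
  proof (intro DERIV_imp_deriv DERIV_sum)
    fix m assume "m \<in> {..<M}"
    then have "loglik p (xs m) differentiable (at (\<theta> + 0 *\<^sub>R axis i 1))"
      using assms by (simp, metis at_within_open differentiable_on_def)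
    then obtain D where D: "((\<lambda>t. loglik p (xs m) (\<theta> + t *\<^sub>R axis i 1)) has_real_derivative D) (at 0)"
      using DERIV_along_line by blast
    moreover have "partial_deriv i (loglik p (xs m)) \<theta> = D"
      unfolding partial_deriv_def by (rule DERIV_imp_deriv[OF D])
    ultimately show "((\<lambda>t. loglik p (xs m) (\<theta> + t *\<^sub>R axis i 1)) has_real_derivative partial_deriv i (loglik p (xs m)) \<theta>) (at 0)"
      by simp
  qed
  then show ?thesis by (simp add: grad_def vec_eq_iff)
qed

text \<open>\<open>arg_max_on\<close> chooses some maximizer; under \<open>A1\<close> the choice is
  forced and the chosen point is stationary.\<close>

lemma mle_stationary:
  assumes "A1 \<nu> p \<Theta>" "M \<ge> 1" "xs \<in> space (PiM {..<M} (\<lambda>_. \<nu>))"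
  shows "mle p \<Theta> M xs \<in> \<Theta>" "grad (sample_loglik p M xs) (mle p \<Theta> M xs) = 0"
proof -
  obtain \<theta>h where h: "\<theta>h \<in> interior \<Theta>"
    "\<And>\<theta>. is_arg_max (sample_loglik p M xs) (\<lambda>\<theta>. \<theta> \<in> \<Theta>) \<theta> \<longleftrightarrow> \<theta> = \<theta>h"
    "\<And>\<theta>. \<theta> \<in> \<Theta> \<Longrightarrow> grad (sample_loglik p M xs) \<theta> = 0 \<longleftrightarrow> \<theta> = \<theta>h"
    using assms unfolding A1_def by metis
  have "mle p \<Theta> M xs = \<theta>h"
    unfolding mle_def arg_max_on_def arg_max_def h(2) by simp
  then show "mle p \<Theta> M xs \<in> \<Theta>" "grad (sample_loglik p M xs) (mle p \<Theta> M xs) = 0"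
    using h interior_subset by auto
qed

text \<open>The deterministic part of the argument, for one sample. The score sum vanishes at the
  estimate \<open>\<theta> + h\<close>, so the expansion expresses the score sum at
  \<open>\<theta>\<close> through the Hessian sum, which is close to \<open>- M * F\<close>. The
  eigenvector \<open>u\<close> turns the main term into \<open>\<kappa> * (h \<bullet> u)\<close>,
  at most \<open>\<kappa> * \<epsilon>\<close>. The other terms are the fluctuation of the Hessian
  entries and the Taylor remainder.\<close>

lemma score_bound_of_mle_near:
  fixes p :: "real^'n::finite \<Rightarrow> 'x \<Rightarrow> real"
  assumes op: "open \<Theta>a" "\<Theta> \<subseteq> \<Theta>a" and A1: "A1 \<nu> p \<Theta>" and A2: "A2 \<nu> p \<Theta>a"
    and M: "M \<ge> 1" and xs: "xs \<in> space (PiM {..<M} (\<lambda>_. \<nu>))"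
    and near: "norm (mle p \<Theta> M xs - \<theta>) \<le> \<epsilon>" and ball: "cball \<theta> \<epsilon> \<subseteq> \<Theta>a"
    and u: "norm u = 1" "F *v u = \<kappa> *\<^sub>R u" "\<kappa> \<ge> 0"
    and G: "\<And>i j k x y. x \<in> space \<nu> \<Longrightarrow> y \<in> cball \<theta> \<epsilon> \<Longrightarrow>
       \<bar>third_deriv (loglik p x) y $ i $ j $ k\<bar> \<le> G i j k x"
    and Gt: "\<And>i j k. (\<Sum>m<M. G i j k (xs m)) / M \<le> t i j k"
    and H: "\<And>i j. \<bar>(\<Sum>m<M. hess (loglik p (xs m)) \<theta> $ i $ j) / M + F $ i $ j\<bar> \<le> \<eta>"
  shows "(\<Sum>m<M. u \<bullet> grad (loglik p (xs m)) \<theta>) / M \<le>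
     \<epsilon> * (\<kappa> + (real CARD('n))\<^sup>2 * \<eta> + \<epsilon> * (\<Sum>i\<in>UNIV. \<Sum>j\<in>UNIV. \<Sum>k\<in>UNIV. t k j i))"
proof -
  define h where "h = mle p \<Theta> M xs - \<theta>"
  define a where "a i j = (\<Sum>m<M. hess (loglik p (xs m)) \<theta> $ i $ j) / M" for i j
  have nh: "norm h \<le> \<epsilon>" using near by (simp add: h_def)
  then have e0: "\<epsilon> \<ge> 0" using norm_ge_zero order_trans by blast
  have x: "xs m \<in> space \<nu>" if "m < M" for m using xs that by (auto simp: space_PiM)
  note mle = mle_stationary[OF A1 M xs]
  have "0 = (\<Sum>m<M. u \<bullet> grad (loglik p (xs m)) (\<theta> + h))"
    using mle op x Ck_on_3D(1)[OF Ck_on_loglik[OF A2]]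
    by (simp add: h_def grad_sample_loglik[of \<Theta>a] inner_sum_right[symmetric] subset_iff)
  moreover have "(\<Sum>m<M. u \<bullet> grad (loglik p (xs m)) \<theta>) \<le> (\<Sum>m<M. u \<bullet> grad (loglik p (xs m)) (\<theta> + h)
      - (\<Sum>i\<in>UNIV. u $ i * (\<Sum>j\<in>UNIV. h $ j * hess (loglik p (xs m)) \<theta> $ j $ i))
      + \<epsilon>\<^sup>2 * (\<Sum>i\<in>UNIV. \<Sum>j\<in>UNIV. \<Sum>k\<in>UNIV. G k j i (xs m)))"
  proof (rule sum_mono)
    fix m assume "m \<in> {..<M}"
    then show "u \<bullet> grad (loglik p (xs m)) \<theta> \<le> u \<bullet> grad (loglik p (xs m)) (\<theta> + h)
      - (\<Sum>i\<in>UNIV. u $ i * (\<Sum>j\<in>UNIV. h $ j * hess (loglik p (xs m)) \<theta> $ j $ i))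
      + \<epsilon>\<^sup>2 * (\<Sum>i\<in>UNIV. \<Sum>j\<in>UNIV. \<Sum>k\<in>UNIV. G k j i (xs m))"
      using score_taylor[OF op(1) Ck_on_loglik[OF A2 x] ball u(1) nh, of m "\<lambda>i j k. G i j k (xs m)"] G[OF x, of m]
      by (auto simp: abs_le_iff)
  qed
  ultimately have "(\<Sum>m<M. u \<bullet> grad (loglik p (xs m)) \<theta>) \<le>
      (\<Sum>m<M. - (\<Sum>i\<in>UNIV. u $ i * (\<Sum>j\<in>UNIV. h $ j * hess (loglik p (xs m)) \<theta> $ j $ i)))
      + (\<Sum>m<M. \<epsilon>\<^sup>2 * (\<Sum>i\<in>UNIV. \<Sum>j\<in>UNIV. \<Sum>k\<in>UNIV. G k j i (xs m)))"
    by (simp add: sum.distrib sum_subtractf sum_negf)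
  also have "(\<Sum>m<M. - (\<Sum>i\<in>UNIV. u $ i * (\<Sum>j\<in>UNIV. h $ j * hess (loglik p (xs m)) \<theta> $ j $ i))) =
     - (\<Sum>i\<in>UNIV. u $ i * (\<Sum>j\<in>UNIV. h $ j * (\<Sum>m<M. hess (loglik p (xs m)) \<theta> $ j $ i)))"
    by (simp add: sum_negf sum_distrib_left sum.swap[of _ UNIV "{..<M}"])
  also have "(\<Sum>m<M. \<epsilon>\<^sup>2 * (\<Sum>i\<in>UNIV. \<Sum>j\<in>UNIV. \<Sum>k\<in>UNIV. G k j i (xs m))) =
     \<epsilon>\<^sup>2 * (\<Sum>i\<in>UNIV. \<Sum>j\<in>UNIV. \<Sum>k\<in>UNIV. (\<Sum>m<M. G k j i (xs m)))"
    by (simp add: sum_distrib_left sum.swap[of _ UNIV "{..<M}"])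
  finally have "(\<Sum>m<M. u \<bullet> grad (loglik p (xs m)) \<theta>) / M \<le>
     (- (\<Sum>i\<in>UNIV. u $ i * (\<Sum>j\<in>UNIV. h $ j * (\<Sum>m<M. hess (loglik p (xs m)) \<theta> $ j $ i)))
     + \<epsilon>\<^sup>2 * (\<Sum>i\<in>UNIV. \<Sum>j\<in>UNIV. \<Sum>k\<in>UNIV. (\<Sum>m<M. G k j i (xs m)))) / M"
    by (rule divide_right_mono) simp
  also have "\<dots> = - (\<Sum>i\<in>UNIV. u $ i * (\<Sum>j\<in>UNIV. h $ j * a j i))
     + \<epsilon>\<^sup>2 * (\<Sum>i\<in>UNIV. \<Sum>j\<in>UNIV. \<Sum>k\<in>UNIV. (\<Sum>m<M. G k j i (xs m)) / M)"
    by (simp add: a_def add_divide_distrib diff_divide_distrib sum_divide_distrib sum_distrib_left minus_divide_left)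
  also have "\<dots> \<le> (\<epsilon> * \<kappa> + \<epsilon> * ((real CARD('n))\<^sup>2 * \<eta>)) + \<epsilon>\<^sup>2 * (\<Sum>i\<in>UNIV. \<Sum>j\<in>UNIV. \<Sum>k\<in>UNIV. t k j i)"
  proof (rule add_mono)
    show "\<epsilon>\<^sup>2 * (\<Sum>i\<in>UNIV. \<Sum>j\<in>UNIV. \<Sum>k\<in>UNIV. (\<Sum>m<M. G k j i (xs m)) / M)
       \<le> \<epsilon>\<^sup>2 * (\<Sum>i\<in>UNIV. \<Sum>j\<in>UNIV. \<Sum>k\<in>UNIV. t k j i)"
      by (intro mult_left_mono sum_mono Gt) auto
    \<comment> \<open>The averaged Hessian is \<open>- F\<close> plus a fluctuation that is at most
      \<open>\<eta>\<close> in every entry.\<close>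
    have split: "- (\<Sum>i\<in>UNIV. u $ i * (\<Sum>j\<in>UNIV. h $ j * a j i)) =
       (\<Sum>i\<in>UNIV. u $ i * (\<Sum>j\<in>UNIV. h $ j * F $ j $ i)) - (\<Sum>i\<in>UNIV. u $ i * (\<Sum>j\<in>UNIV. h $ j * (a j i + F $ j $ i)))"
      by (simp add: distrib_left sum.distrib)
    have "(\<Sum>i\<in>UNIV. u $ i * (\<Sum>j\<in>UNIV. h $ j * F $ j $ i)) = h \<bullet> (F *v u)"
      by (simp add: inner_vec_def matrix_vector_mult_def sum_distrib_left mult_ac) (rule sum.swap)
    also have "\<dots> = \<kappa> * (h \<bullet> u)" using u by simp
    also have "\<dots> \<le> \<kappa> * \<epsilon>"
      using u nh norm_cauchy_schwarz[of h u] by (intro mult_left_mono) auto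
    finally have main: "(\<Sum>i\<in>UNIV. u $ i * (\<Sum>j\<in>UNIV. h $ j * F $ j $ i)) \<le> \<epsilon> * \<kappa>" by (simp add: mult_ac)
    have "\<bar>\<Sum>i\<in>UNIV. u $ i * (\<Sum>j\<in>UNIV. h $ j * (a j i + F $ j $ i))\<bar>
        \<le> (\<Sum>i\<in>(UNIV::'n set). 1 * (\<Sum>j\<in>(UNIV::'n set). \<epsilon> * \<eta>))"
    proof (intro order_trans[OF sum_abs] sum_mono order_trans[OF eq_refl[OF abs_mult]] mult_mono)
      show "\<bar>u $ i\<bar> \<le> 1" for i using component_le_norm_cart[of u i] u by simp
      show "\<bar>h $ i\<bar> \<le> \<epsilon>" for i using component_le_norm_cart[of h i] nh by simp
      show "\<bar>a j i + F $ j $ i\<bar> \<le> \<eta>" for i j using H by (simp add: a_def)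
    qed (use e0 in \<open>auto intro!: sum_nonneg\<close>)
    also have "\<dots> = \<epsilon> * ((real CARD('n))\<^sup>2 * \<eta>)" by (simp add: power2_eq_square)
    finally show "- (\<Sum>i\<in>UNIV. u $ i * (\<Sum>j\<in>UNIV. h $ j * a j i)) \<le> \<epsilon> * \<kappa> + \<epsilon> * ((real CARD('n))\<^sup>2 * \<eta>)"
      using split main by linarith
  qed
  finally show ?thesis by (simp add: algebra_simps power2_eq_square)
qed

section \<open>The Fisher information matrix and its inverse\<close>

lemma bounded_linear_quadratic_form: "bounded_linear (\<lambda>A::real^'n^('n::finite). u \<bullet> (A *v u))"
proof -
  have "linear (\<lambda>A::real^'n^'n. u \<bullet> (A *v u))"
    by (rule linearI) (simp_all add: matrix_vector_mult_add_rdistrib inner_add_right scaleR_matrix_vector_assoc[symmetric])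
  then show ?thesis by (simp add: linear_conv_bounded_linear)
qed

lemma bounded_linear_entry: "bounded_linear (\<lambda>A::real^'n::finite^'m::finite. A $ i $ j)"
  using bounded_linear_compose[OF bounded_linear_vec_nth bounded_linear_vec_nth] .

lemma score_outer_quadratic: "u \<bullet> (score_outer p \<theta> x *v u) = (u \<bullet> grad (loglik p x) \<theta>)\<^sup>2"
proof -
  have "score_outer p \<theta> x *v u = (u \<bullet> grad (loglik p x) \<theta>) *\<^sub>R grad (loglik p x) \<theta>"
    by (simp add: vec_eq_iff score_outer_def matrix_vector_mult_def inner_vec_def sum_distrib_left sum_distrib_right mult_ac)
  then show ?thesis by (simp add: power2_eq_square)
qed

text \<open>The Fisher matrix is a matrix-valued Bochner integral, with which the quadratic form
  commutes as a bounded linear functional of the matrix; on an outer product the form is a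
  square.\<close>

lemma score_second_moment:
  assumes "score_identities \<nu> p \<Theta>" "\<theta> \<in> \<Theta>"
  shows "integrable (outcome_law \<nu> p \<theta>) (\<lambda>x. (u \<bullet> grad (loglik p x) \<theta>)\<^sup>2)"
    "(\<integral>x. (u \<bullet> grad (loglik p x) \<theta>)\<^sup>2 \<partial>outcome_law \<nu> p \<theta>) = u \<bullet> (fisher \<nu> p \<theta> *v u)"
proof -
  have *: "integrable (outcome_law \<nu> p \<theta>) (score_outer p \<theta>)" using assms by (simp add: score_identities_def)
  show "integrable (outcome_law \<nu> p \<theta>) (\<lambda>x. (u \<bullet> grad (loglik p x) \<theta>)\<^sup>2)"
    using integrable_bounded_linear[OF bounded_linear_quadratic_form[of u] *] by (simp add: score_outer_quadratic)
  show "(\<integral>x. (u \<bullet> grad (loglik p x) \<theta>)\<^sup>2 \<partial>outcome_law \<nu> p \<theta>) = u \<bullet> (fisher \<nu> p \<theta> *v u)"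
    using integral_bounded_linear[OF bounded_linear_quadratic_form[of u] *] by (simp add: score_outer_quadratic fisher_def)
qed

lemma transpose_fisher:
  assumes "score_identities \<nu> p \<Theta>" "\<theta> \<in> \<Theta>"
  shows "transpose (fisher \<nu> p \<theta>) = fisher \<nu> p \<theta>"
proof -
  have *: "integrable (outcome_law \<nu> p \<theta>) (score_outer p \<theta>)" using assms by (simp add: score_identities_def)
  have "fisher \<nu> p \<theta> $ i $ j = (\<integral>x. score_outer p \<theta> x $ i $ j \<partial>outcome_law \<nu> p \<theta>)" for i j
    unfolding fisher_def by (rule integral_bounded_linear[OF bounded_linear_entry *, symmetric])
  moreover have "score_outer p \<theta> x $ i $ j = score_outer p \<theta> x $ j $ i" for x i j
    by (simp add: score_outer_def)
  ultimately show ?thesis by (simp add: transpose_def vec_eq_iff)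
qed

lemma matrix_inv_inverse:
  fixes A :: "real^'n^('n::finite)"
  assumes "invertible A"
  shows "A ** matrix_inv A = mat 1" "matrix_inv A ** A = mat 1"
  using someI_ex[OF assms[unfolded invertible_def]] unfolding matrix_inv_def by auto

lemma transpose_matrix_inv:
  fixes A :: "real^'n^('n::finite)"
  assumes "invertible A" "transpose A = A"
  shows "transpose (matrix_inv A) = matrix_inv A"
proof -
  have "transpose (matrix_inv A) ** A = mat 1"
    using matrix_inv_inverse[OF assms(1)] assms(2) by (metis matrix_transpose_mul transpose_mat)
  then show ?thesis
    using matrix_inv_inverse(1)[OF assms(1)] by (metis matrix_mul_assoc matrix_mul_lid matrix_mul_rid)
qed

text \<open>A top eigenvector of the inverse is an eigenvector of the Fisher matrix for the
  reciprocal value. Positivity of \<open>\<mu>\<close> follows from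
  \<open>1 = \<mu> * (u \<bullet> (F *v u))\<close> with \<open>F\<close> the Fisher matrix, whose
  quadratic form is a second moment.\<close>

lemma fisher_eigenvector:
  fixes p :: "real^'n::finite \<Rightarrow> 'x \<Rightarrow> real"
  assumes score: "score_identities \<nu> p \<Theta>" and R2: "R2 \<nu> p \<Theta>" and \<theta>: "\<theta> \<in> \<Theta>"
  defines "\<mu> \<equiv> mu_max (matrix_inv (fisher \<nu> p \<theta>))"
  obtains u where "norm u = 1" "fisher \<nu> p \<theta> *v u = (1 / \<mu>) *\<^sub>R u" "\<mu> > 0"
proof -
  let ?F = "fisher \<nu> p \<theta>"
  have inv: "invertible ?F" using R2 \<theta> by (simp add: R2_def)
  have tr: "transpose (matrix_inv ?F) = matrix_inv ?F"
    by (intro transpose_matrix_inv inv transpose_fisher[OF score \<theta>])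
  obtain u where u: "norm u = 1" "matrix_inv ?F *v u = \<mu> *\<^sub>R u"
    using mu_max_symmetric[OF tr] unfolding \<mu>_def by blast
  have "?F ** matrix_inv ?F = mat 1" by (rule matrix_inv_inverse[OF inv])
  then have eq: "u = \<mu> *\<^sub>R (?F *v u)"
    using u(2) by (metis matrix_vector_mul_assoc matrix_vector_mul_lid matrix_vector_mult_scaleR)
  have "0 \<le> u \<bullet> (?F *v u)"
    unfolding score_second_moment(2)[OF score \<theta>, symmetric] by (rule integral_nonneg_AE) simp
  moreover have "1 = \<mu> * (u \<bullet> (?F *v u))"
    using u(1) arg_cong[OF eq, of "\<lambda>v. u \<bullet> v"] by (simp add: dot_square_norm)
  ultimately have "\<mu> > 0" by (metis linorder_not_le mult_nonpos_nonneg not_one_le_zero)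
  moreover have "?F *v u = (1 / \<mu>) *\<^sub>R u" by (subst (2) eq) (use \<open>\<mu> > 0\<close> in simp)
  ultimately show ?thesis using u that by blast
qed

section \<open>Failure of the guarantee for too few repetitions\<close>

lemma filterlim_repetitions:
  assumes "c > 0"
  shows "filterlim (\<lambda>\<epsilon>::real. nat \<lceil>c / \<epsilon>\<^sup>2\<rceil>) at_top (at_right 0)"
  unfolding filterlim_at_top
proof
  fix n :: nat
  have "filterlim (\<lambda>\<epsilon>::real. c / \<epsilon>\<^sup>2) at_top (at_right 0)" using assms by real_asymp
  then have "\<forall>\<^sub>F \<epsilon> in at_right 0. real n \<le> c / \<epsilon>\<^sup>2" unfolding filterlim_at_top by blast
  then show "\<forall>\<^sub>F \<epsilon> in at_right 0. n \<le> nat \<lceil>c / \<epsilon>\<^sup>2\<rceil>"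
    by eventually_elim linarith
qed

text \<open>The success event lies in the union of the central limit event and finitely many
  law-of-large-numbers events, whose total probability falls below
  \<open>1 - \<delta>\<close>.\<close>

lemma not_ml_guarantee:
  fixes p :: "real^'n::finite \<Rightarrow> 'x \<Rightarrow> real"
  assumes model: "statistical_model \<nu> p \<Theta> \<Theta>a" and score: "score_identities \<nu> p \<Theta>"
    and A1: "A1 \<nu> p \<Theta>" and A2: "A2 \<nu> p \<Theta>a" and R1: "R1 \<Theta> \<Theta>a r0"
    and R2: "R2 \<nu> p \<Theta>" and R4: "R4 \<nu> p \<Theta> r0"
    and delta: "0 < \<delta>" "\<delta> < 1 / sqrt (8 * pi * exp 1)"
    and \<theta>: "\<theta> \<in> \<Theta>" and c: "0 < c"
    "c < lambert_W0 (\<delta> powi (-2) / (8 * pi)) * mu_max (matrix_inv (fisher \<nu> p \<theta>))"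
  shows "\<forall>\<^sub>F \<epsilon> in at_right 0. \<not> ml_guarantee \<nu> p \<Theta> \<epsilon> \<delta> (nat \<lceil>c / \<epsilon>\<^sup>2\<rceil>)"
proof -
  let ?F = "fisher \<nu> p \<theta>" and ?P = "outcome_law \<nu> p \<theta>"
  let ?Q = "PiM UNIV (\<lambda>_::nat. ?P)"
  define w where "w = lambert_W0 (\<delta> powi (-2) / (8 * pi))"
  have pP: "prob_space ?P" using model \<theta> by (auto simp: statistical_model_def)
  interpret P: prob_space ?P by fact
  interpret Q: prob_space ?Q by (intro prob_space_PiM pP)
  obtain u where u: "norm u = 1" "?F *v u = (1 / mu_max (matrix_inv ?F)) *\<^sub>R u" "mu_max (matrix_inv ?F) > 0"
    using fisher_eigenvector[OF score R2 \<theta>] by blast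
  define \<kappa> where "\<kappa> = 1 / mu_max (matrix_inv ?F)"
  have \<kappa>: "\<kappa> > 0" "?F *v u = \<kappa> *\<^sub>R u" using u by (auto simp: \<kappa>_def)
  have "w > 1" unfolding w_def by (rule lambert_W0_gt_1[OF delta])
  have "c * \<kappa> < w" using c(2) u(3) by (simp add: \<kappa>_def w_def field_simps)
  then have "max 1 (sqrt (c * \<kappa>)) < sqrt w" using \<open>w > 1\<close> by simp
  \<comment> \<open>\<open>b\<close> must be at least 1 for the tail bound, exceed
    \<open>sqrt (c * \<kappa>)\<close>, the leading part of the normalized score bound, and stay
    below \<open>sqrt w\<close> for the tail to exceed \<open>\<delta>\<close>.\<close>
  then obtain b where b: "max 1 (sqrt (c * \<kappa>)) < b" "b < sqrt w" using dense by blast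
  have b1: "1 \<le> b" "sqrt (c * \<kappa>) < b" using b by auto
  have tail: "\<delta> < std_normal_density b / (2 * b)"
    using std_normal_density_lambert_W0[OF delta(1) b1(1)] b(2) by (simp add: w_def)
  have "cdf std_normal_distribution b < 1 - \<delta>" using cdf_std_normal_le[OF b1(1)] tail by linarith
  \<comment> \<open>This leads to \<open>\<delta> < 1\<close>, so that the guaranteed probability is
    positive; the measurability argument below relies on it.\<close>
  have "1 < sqrt (8 * pi * exp 1)"
  proof -
    have "1 * 3 * 1 \<le> 8 * pi * exp 1" using pi_gt3 by (intro mult_mono) auto
    then show ?thesis by simp
  qed
  then have "1 / sqrt (8 * pi * exp 1) < 1" by (simp add: divide_less_eq)
  then have "\<delta> < 1" using delta(2) by linarith

  obtain G where G: "\<And>i j k. integrable ?P (G i j k)"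
    "\<And>i j k x y. x \<in> space \<nu> \<Longrightarrow> y \<in> cball \<theta> r0 \<Longrightarrow>
       \<bar>third_deriv (loglik p x) y $ i $ j $ k\<bar> \<le> G i j k x"
    using third_deriv_envelope[OF model A2 R1 R4 \<theta>] by blast
  \<comment> \<open>The mean plus a slack of 1, which a sample average exceeds with vanishing
    probability. The size of the slack is immaterial, as the sum \<open>T\<close> gets multiplied by
    \<open>\<epsilon>\<close>.\<close>
  define t where "t i j k = (\<integral>x. G i j k x \<partial>?P) + 1" for i j k
  define T where "T = (\<Sum>i\<in>UNIV. \<Sum>j\<in>UNIV. \<Sum>k\<in>UNIV. t k j i)"
  define N where "N = (real CARD('n))\<^sup>2"
  have "N > 0" by (simp add: N_def)
  \<comment> \<open>With this \<open>\<eta>\<close>, the limit as \<open>\<epsilon> \<rightarrow> 0\<close> of the normalized score bound is the midpoint of \<open>sqrt (c * \<kappa>)\<close> and \<open>b\<close>.\<close>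
  define \<eta> where "\<eta> = (b - sqrt (c * \<kappa>)) / (2 * N * sqrt (c / \<kappa>))"
  have "\<eta> > 0" using b1 \<kappa> c \<open>N > 0\<close> by (simp add: \<eta>_def)
  \<comment> \<open>With \<open>M\<close> the rounded-up \<open>c / \<epsilon>\<^sup>2\<close>,
    rounding adds at most one repetition, so \<open>M * \<epsilon>\<^sup>2\<close> is at most
    \<open>c + \<epsilon>\<^sup>2\<close>.\<close>
  have lim_bound: "((\<lambda>\<epsilon>. sqrt ((c + \<epsilon>\<^sup>2) / \<kappa>) * (\<kappa> + N * \<eta> + \<epsilon> * T)) \<longlongrightarrow> sqrt ((c + 0\<^sup>2) / \<kappa>) * (\<kappa> + N * \<eta> + 0 * T)) (at_right 0)"
    by (intro tendsto_intros) (use \<kappa> in auto)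
  have "sqrt (c / \<kappa>) * \<kappa> = sqrt (c * \<kappa>)"
    using \<kappa> by (simp add: real_sqrt_divide real_sqrt_mult field_simps)
  moreover have "sqrt (c / \<kappa>) * (N * \<eta>) = (b - sqrt (c * \<kappa>)) / 2"
    using c \<kappa> \<open>N > 0\<close> by (simp add: \<eta>_def)
  ultimately have "sqrt (c / \<kappa>) * (\<kappa> + N * \<eta>) = (b + sqrt (c * \<kappa>)) / 2"
    unfolding distrib_left by (simp add: field_simps)
  then have "sqrt (c / \<kappa>) * (\<kappa> + N * \<eta>) < b" using b1(2) by simp
  then have ev_bound: "\<forall>\<^sub>F \<epsilon> in at_right 0. sqrt ((c + \<epsilon>\<^sup>2) / \<kappa>) * (\<kappa> + N * \<eta> + \<epsilon> * T) < b"
    using order_tendstoD(2)[OF lim_bound] by simp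

  define s where "s x = u \<bullet> grad (loglik p x) \<theta>" for x
  have "has_bochner_integral ?P (\<lambda>x. grad (loglik p x) \<theta>) 0"
    using score \<theta> by (simp add: score_identities_def)
  from has_bochner_integral_bounded_linear[OF bounded_linear_inner_right[of u] this]
  have s_mean: "integrable ?P s" "(\<integral>x. s x \<partial>?P) = 0"
    unfolding s_def by (auto simp: has_bochner_integral_iff)
  have s_sq: "integrable ?P (\<lambda>x. (s x)\<^sup>2)" "(\<integral>x. (s x)\<^sup>2 \<partial>?P) = \<kappa>"
    using score_second_moment[OF score \<theta>, of u] u(1) \<kappa>(2) by (auto simp: s_def dot_square_norm)
  define H where "H i j x = hess (loglik p x) \<theta> $ i $ j" for i j x
  have H: "integrable ?P (H i j)" "(\<integral>x. H i j x \<partial>?P) = - ?F $ i $ j" for i j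
  proof -
    have "has_bochner_integral ?P (\<lambda>x. hess (loglik p x) \<theta>) (- ?F)"
      using score \<theta> by (simp add: score_identities_def)
    from has_bochner_integral_bounded_linear[OF bounded_linear_entry[of i j] this]
    show "integrable ?P (H i j)" "(\<integral>x. H i j x \<partial>?P) = - ?F $ i $ j"
      unfolding H_def by (auto simp: has_bochner_integral_iff)
  qed
  define Z where "Z n = {\<omega> \<in> space ?Q. (\<Sum>i<n. s (\<omega> i)) / sqrt (real n * \<kappa>) \<le> b}" for n
  define E where "E f e n = {\<omega> \<in> space ?Q. \<bar>(\<Sum>i<n. f (\<omega> i)) / real n - (\<integral>x. f x \<partial>?P)\<bar> \<ge> e}" for f :: "'x \<Rightarrow> real" and e n
  have [measurable]: "s \<in> borel_measurable ?P" using s_mean by auto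
  have Z_sets: "Z n \<in> sets ?Q" for n unfolding Z_def by measurable
  have E_sets: "E f e n \<in> sets ?Q" if "integrable ?P f" for f e n
  proof -
    have [measurable]: "f \<in> borel_measurable ?P" using that by auto
    show ?thesis unfolding E_def by measurable
  qed
  \<comment> \<open>The union bound as a function of the sample size alone: the events do not
    involve \<open>\<epsilon>\<close>, so its limit can be composed with the growing number of
    repetitions.\<close>
  define r where "r n = measure ?Q (Z n) + ((\<Sum>(i, j)\<in>UNIV. measure ?Q (E (H i j) \<eta> n)) +
      (\<Sum>(i, j, k)\<in>UNIV. measure ?Q (E (G i j k) 1 n)))" for n
  have "r \<longlonglongrightarrow> cdf std_normal_distribution b + ((\<Sum>(i::'n, j::'n)\<in>UNIV. 0) + (\<Sum>(i::'n, j::'n, k::'n)\<in>UNIV. 0))"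
    unfolding r_def
  proof (intro tendsto_add tendsto_sum)
    show "(\<lambda>n. measure ?Q (Z n)) \<longlonglongrightarrow> cdf std_normal_distribution b"
      unfolding Z_def by (rule central_limit_upper[OF pP _ s_mean(2) s_sq \<kappa>(1)]) measurable
    show "(\<lambda>n. case ij of (i, j) \<Rightarrow> measure ?Q (E (H i j) \<eta> n)) \<longlonglongrightarrow> (case ij of (i, j) \<Rightarrow> 0)" for ij
      unfolding E_def by (cases ij) (auto intro!: weak_law_of_large_numbers pP H \<open>\<eta> > 0\<close>)
    show "(\<lambda>n. case ijk of (i, j, k) \<Rightarrow> measure ?Q (E (G i j k) 1 n)) \<longlonglongrightarrow> (case ijk of (i, j, k) \<Rightarrow> 0)" for ijk
      unfolding E_def by (cases ijk) (auto intro!: weak_law_of_large_numbers pP G)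
  qed
  then have "r \<longlonglongrightarrow> cdf std_normal_distribution b" by (simp add: case_prod_unfold)
  then have "\<forall>\<^sub>F n in sequentially. r n < 1 - \<delta>"
    using \<open>cdf std_normal_distribution b < 1 - \<delta>\<close> by (rule order_tendstoD(2))
  then have ev_r: "\<forall>\<^sub>F \<epsilon> in at_right 0. r (nat \<lceil>c / \<epsilon>\<^sup>2\<rceil>) < 1 - \<delta>"
    by (rule eventually_compose_filterlim[OF _ filterlim_repetitions[OF c(1)]])
  have "r0 > 0" using R1 by (simp add: R1_def)
  have ev_small: "\<forall>\<^sub>F \<epsilon> in at_right 0. 0 < \<epsilon> \<and> \<epsilon> < r0"
    using \<open>r0 > 0\<close> by (auto simp: eventually_at_right)
  from ev_bound ev_r ev_small show ?thesis
  proof eventually_elim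
    fix \<epsilon> assume bound: "sqrt ((c + \<epsilon>\<^sup>2) / \<kappa>) * (\<kappa> + N * \<eta> + \<epsilon> * T) < b"
      and rM: "r (nat \<lceil>c / \<epsilon>\<^sup>2\<rceil>) < 1 - \<delta>" and eps: "0 < \<epsilon> \<and> \<epsilon> < r0"
    define M where "M = nat \<lceil>c / \<epsilon>\<^sup>2\<rceil>"
    have M0: "0 < c / \<epsilon>\<^sup>2" using c eps by simp
    then have M1: "M \<ge> 1" by (simp add: M_def Suc_le_eq)
    have "real M \<le> c / \<epsilon>\<^sup>2 + 1" unfolding M_def using M0 by linarith
    then have M_le: "real M * \<epsilon>\<^sup>2 \<le> c + \<epsilon>\<^sup>2" using eps by (simp add: field_simps)
    have cb: "cball \<theta> \<epsilon> \<subseteq> cball \<theta> r0" using eps by auto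
    have cba: "cball \<theta> \<epsilon> \<subseteq> \<Theta>a"
    proof
      fix y assume "y \<in> cball \<theta> \<epsilon>"
      then have "norm (y - \<theta>) \<le> r0" using eps by (simp add: dist_norm norm_minus_commute)
      then have "\<theta> + (y - \<theta>) \<in> \<Theta>a" using R1 \<theta> unfolding R1_def by blast
      then show "y \<in> \<Theta>a" by simp
    qed
    show "\<not> ml_guarantee \<nu> p \<Theta> \<epsilon> \<delta> (nat \<lceil>c / \<epsilon>\<^sup>2\<rceil>)"
      unfolding M_def[symmetric]
    proof
      assume g: "ml_guarantee \<nu> p \<Theta> \<epsilon> \<delta> M"
      define A where "A = {xs \<in> space (sample_law \<nu> p M \<theta>). norm (mle p \<Theta> M xs - \<theta>) \<le> \<epsilon>}"
      have A_ge: "1 - \<delta> \<le> measure (PiM {..<M} (\<lambda>_. ?P)) A"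
        using g \<theta> unfolding ml_guarantee_def A_def sample_law_def by blast
      \<comment> \<open>A non-measurable set would have measure 0, so the guarantee entails measurability.\<close>
      then have "A \<in> sets (PiM {..<M} (\<lambda>_. ?P))"
        using \<open>\<delta> < 1\<close> measure_notin_sets[of A "PiM {..<M} (\<lambda>_. ?P)"] by fastforce
      then have "measure (PiM {..<M} (\<lambda>_. ?P)) A =
          measure ?Q {\<omega> \<in> space ?Q. restrict \<omega> {..<M} \<in> A}"
        by (rule measure_PiM_lessThan[OF pP])
      also have "\<dots> \<le> measure ?Q (Z M \<union> ((\<Union>(i, j)\<in>UNIV. E (H i j) \<eta> M) \<union> (\<Union>(i, j, k)\<in>UNIV. E (G i j k) 1 M)))"
      proof (rule Q.finite_measure_mono)
        \<comment> \<open>A success outside all exceptional events satisfies the hypotheses of the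
          deterministic bound, which pushes the normalized score sum below \<open>b\<close> and thus
          into \<open>Z M\<close>.\<close>
        show "{\<omega> \<in> space ?Q. restrict \<omega> {..<M} \<in> A} \<subseteq>
           Z M \<union> ((\<Union>(i, j)\<in>UNIV. E (H i j) \<eta> M) \<union> (\<Union>(i, j, k)\<in>UNIV. E (G i j k) 1 M))"
        proof (rule subsetI, rule ccontr)
          fix \<omega> assume "\<omega> \<in> {\<omega> \<in> space ?Q. restrict \<omega> {..<M} \<in> A}"
            and n: "\<omega> \<notin> Z M \<union> ((\<Union>(i, j)\<in>UNIV. E (H i j) \<eta> M) \<union> (\<Union>(i, j, k)\<in>UNIV. E (G i j k) 1 M))"
          then have \<omega>: "\<omega> \<in> space ?Q" and rA: "restrict \<omega> {..<M} \<in> A" by auto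
          have nZ: "b < (\<Sum>i<M. s (\<omega> i)) / sqrt (real M * \<kappa>)" using n \<omega> by (auto simp: Z_def)
          have nH: "\<bar>(\<Sum>m<M. H i j (\<omega> m)) / M + ?F $ i $ j\<bar> \<le> \<eta>" for i j
          proof -
            have "\<omega> \<notin> E (H i j) \<eta> M" using n by auto
            then show ?thesis using \<omega> by (auto simp: E_def H)
          qed
          have nG: "(\<Sum>m<M. G i j k (\<omega> m)) / M \<le> t i j k" for i j k
          proof -
            have "\<omega> \<notin> E (G i j k) 1 M" using n by auto
            then show ?thesis using \<omega> by (auto simp: E_def t_def)
          qed
          have "(\<Sum>m<M. u \<bullet> grad (loglik p (restrict \<omega> {..<M} m)) \<theta>) / M \<le> \<epsilon> * (\<kappa> + (real CARD('n))\<^sup>2 * \<eta> + \<epsilon> *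
              (\<Sum>i\<in>UNIV. \<Sum>j\<in>UNIV. \<Sum>k\<in>UNIV. t k j i))"
          proof (rule score_bound_of_mle_near[OF _ _ A1 A2 M1 _ _ cba u(1) \<kappa>(2)])
            show "restrict \<omega> {..<M} \<in> space (PiM {..<M} (\<lambda>_. \<nu>))"
              using \<omega> by (auto simp: space_PiM)
            show "norm (mle p \<Theta> M (restrict \<omega> {..<M}) - \<theta>) \<le> \<epsilon>" using rA by (simp add: A_def)
            show "\<bar>third_deriv (loglik p x) y $ i $ j $ k\<bar> \<le> G i j k x"
              if "x \<in> space \<nu>" "y \<in> cball \<theta> \<epsilon>" for i j k x y
              using G(2) that cb by blast
            show "(\<Sum>m<M. G i j k (restrict \<omega> {..<M} m)) / M \<le> t i j k" for i j k using nG by simp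
            show "\<bar>(\<Sum>m<M. hess (loglik p (restrict \<omega> {..<M} m)) \<theta> $ i $ j) / M + ?F $ i $ j\<bar> \<le> \<eta>" for i j
              using nH[of i j] by (simp add: H_def)
          qed (use model \<kappa> in \<open>auto simp: statistical_model_def\<close>)
          then have S: "(\<Sum>m<M. s (\<omega> m)) / M \<le> \<epsilon> * (\<kappa> + N * \<eta> + \<epsilon> * T)"
            by (simp add: s_def N_def T_def)
          \<comment> \<open>The sign is needed to enlarge the square-root factor in the estimate
            below. A negative bound would make the score sum negative, although it exceeds a
            positive multiple of \<open>b\<close>.\<close>
          have "0 \<le> \<epsilon> * (\<kappa> + N * \<eta> + \<epsilon> * T)"
          proof (rule ccontr)
            assume "\<not> ?thesis"
            then have "(\<Sum>m<M. s (\<omega> m)) / M < 0" using S by linarith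
            then have "(\<Sum>m<M. s (\<omega> m)) < 0" by (simp add: divide_less_0_iff)
            then have "(\<Sum>m<M. s (\<omega> m)) / sqrt (real M * \<kappa>) < 0" using M1 \<kappa> by (simp add: divide_neg_pos)
            then show False using nZ b1 by linarith
          qed
          then have pos: "0 \<le> \<kappa> + N * \<eta> + \<epsilon> * T" using eps by (simp add: zero_le_mult_iff)
          have "(\<Sum>m<M. s (\<omega> m)) / sqrt (real M * \<kappa>) = (\<Sum>m<M. s (\<omega> m)) / M * sqrt (M / \<kappa>)"
          proof -
            have "1 / sqrt (real M * \<kappa>) = sqrt (M / \<kappa>) / M"
              using M1 \<kappa> by (simp add: real_sqrt_divide real_sqrt_mult field_simps)
            then show ?thesis by (metis mult.commute times_divide_eq_left times_divide_eq_right mult_1)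
          qed
          also have "\<dots> \<le> \<epsilon> * (\<kappa> + N * \<eta> + \<epsilon> * T) * sqrt (M / \<kappa>)"
            using S \<kappa> by (intro mult_right_mono) auto
          also have "\<dots> = sqrt (M * \<epsilon>\<^sup>2 / \<kappa>) * (\<kappa> + N * \<eta> + \<epsilon> * T)"
            using eps by (simp add: real_sqrt_divide real_sqrt_mult mult_ac)
          also have "\<dots> \<le> sqrt ((c + \<epsilon>\<^sup>2) / \<kappa>) * (\<kappa> + N * \<eta> + \<epsilon> * T)"
            using M_le \<kappa> pos by (intro mult_right_mono real_sqrt_le_mono divide_right_mono) auto
          also have "\<dots> < b" by (rule bound)
          finally show False using nZ by simp
        qed
        show "Z M \<union> ((\<Union>(i, j)\<in>UNIV. E (H i j) \<eta> M) \<union> (\<Union>(i, j, k)\<in>UNIV. E (G i j k) 1 M)) \<in> sets ?Q"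
          using Z_sets E_sets[OF H(1)] E_sets[OF G(1)]
          by (intro sets.Un sets.finite_UN) (auto simp: case_prod_unfold)
      qed
      also have "\<dots> \<le> measure ?Q (Z M) + measure ?Q ((\<Union>(i, j)\<in>UNIV. E (H i j) \<eta> M) \<union> (\<Union>(i, j, k)\<in>UNIV. E (G i j k) 1 M))"
        using Z_sets E_sets[OF H(1)] E_sets[OF G(1)]
        by (intro measure_Un_le sets.Un sets.finite_UN) (auto simp: case_prod_unfold)
      also have "\<dots> \<le> measure ?Q (Z M) + (measure ?Q (\<Union>(i, j)\<in>UNIV. E (H i j) \<eta> M) + measure ?Q (\<Union>(i, j, k)\<in>UNIV. E (G i j k) 1 M))"
        using E_sets[OF H(1)] E_sets[OF G(1)]
        by (intro add_left_mono measure_Un_le sets.finite_UN) (auto simp: case_prod_unfold)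
      also have "\<dots> \<le> r M"
        unfolding r_def using E_sets[OF H(1)] E_sets[OF G(1)]
        by (intro add_left_mono add_mono order_trans[OF measure_UNION_le] sum_mono) (auto simp: case_prod_unfold)
      finally show False using A_ge rM by (simp add: M_def)
    qed
  qed
qed

section \<open>From failing repetition numbers to the asymptotic bound\<close>

text \<open>Makes the real supremum in the final bound a genuine one: each eigenvalue is at most the
  operator norm, which \<open>R2\<close> bounds uniformly.\<close>

lemma bdd_above_mu_max:
  fixes p :: "real^'n::finite \<Rightarrow> 'x \<Rightarrow> real"
  assumes score: "score_identities \<nu> p \<Theta>" and R2: "R2 \<nu> p \<Theta>"
  shows "bdd_above ((\<lambda>\<theta>. mu_max (matrix_inv (fisher \<nu> p \<theta>))) ` \<Theta>)"
proof -
  let ?S = "SUP \<theta>\<in>\<Theta>. ennreal (onorm ((*v) (matrix_inv (fisher \<nu> p \<theta>))))"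
  have "?S < \<infinity>" using R2 by (simp add: R2_def)
  then obtain K where K: "0 \<le> K" "?S = ennreal K" by (cases ?S) auto
  show ?thesis
  proof (rule bdd_aboveI2)
    fix \<theta> assume \<theta>: "\<theta> \<in> \<Theta>"
    then have "ennreal (onorm ((*v) (matrix_inv (fisher \<nu> p \<theta>)))) \<le> ennreal K"
      unfolding K(2)[symmetric] by (rule SUP_upper)
    then have "onorm ((*v) (matrix_inv (fisher \<nu> p \<theta>))) \<le> K" using K(1) by simp
    moreover have "invertible (fisher \<nu> p \<theta>)" using R2 \<theta> by (simp add: R2_def)
    ultimately show "mu_max (matrix_inv (fisher \<nu> p \<theta>)) \<le> K"
      using mu_max_le_onorm[OF transpose_matrix_inv[OF _ transpose_fisher[OF score \<theta>]]] by fastforce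
  qed
qed

text \<open>An admissible \<open>M0\<close> requires success for all larger numbers too, so a single
  failing number lies strictly below every admissible one, however the guarantee behaves for smaller
  samples.\<close>

lemma min_repetitions_ge:
  assumes "\<not> ml_guarantee \<nu> p \<Theta> \<epsilon> \<delta> (nat \<lceil>a\<rceil>)"
  shows "ereal a \<le> ereal_of_enat (min_repetitions \<nu> p \<Theta> \<epsilon> \<delta>)"
proof (cases "min_repetitions \<nu> p \<Theta> \<epsilon> \<delta>")
  case (enat m)
  let ?S = "{M0. 1 \<le> M0 \<and> (\<forall>M\<ge>M0. ml_guarantee \<nu> p \<Theta> \<epsilon> \<delta> M)}"
  have "?S \<noteq> {}" using enat by (auto simp: min_repetitions_def Inf_enat_def split: if_splits)
  then have "min_repetitions \<nu> p \<Theta> \<epsilon> \<delta> \<in> enat ` ?S"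
    unfolding min_repetitions_def Inf_enat_def by (auto intro: LeastI)
  then have "m \<in> ?S" using enat by auto
  then have "\<not> m \<le> nat \<lceil>a\<rceil>" using assms by auto
  then have "a \<le> real m" by linarith
  then show ?thesis using enat by simp
qed simp

text \<open>For a level \<open>y < 1\<close> pick \<open>z\<close> between \<open>max y 0\<close>
  and 1 and use \<open>c = z * K\<close>: the ratio is then eventually at least \<open>z\<close>.
  The maximum with 0 keeps \<open>c\<close> positive even when \<open>y\<close> is negative or minus
  infinity.\<close>

lemma asymp_ge_inverse_square:
  fixes A :: "real \<Rightarrow> ereal" and K :: real
  assumes "K > 0"
    and ev: "\<And>c. 0 < c \<Longrightarrow> c < K \<Longrightarrow> \<forall>\<^sub>F \<epsilon> in at_right 0. ereal (c / \<epsilon>\<^sup>2) \<le> A \<epsilon>"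
  shows "A \<greatersim> (\<lambda>\<epsilon>. ereal (K * \<epsilon> powi (-2)))"
  unfolding asymp_ge_def le_Liminf_iff
proof (intro allI impI)
  fix y :: ereal assume "y < 1"
  then have "max y 0 < 1" by simp
  then obtain z where z: "max y 0 < ereal z" "ereal z < 1" using ereal_dense2 by blast
  then have z': "0 < z" "z < 1" "y < ereal z" by auto
  have "\<forall>\<^sub>F \<epsilon> in at_right 0. ereal ((z * K) / \<epsilon>\<^sup>2) \<le> A \<epsilon>"
    using z' assms(1) by (intro ev) auto
  moreover have "\<forall>\<^sub>F \<epsilon> in at_right (0::real). \<epsilon> > 0" by (auto simp: eventually_at_right_less)
  ultimately show "\<forall>\<^sub>F \<epsilon> in at_right 0. y < A \<epsilon> / ereal (K * \<epsilon> powi (-2))"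
  proof eventually_elim
    fix \<epsilon> :: real assume A: "ereal ((z * K) / \<epsilon>\<^sup>2) \<le> A \<epsilon>" and "\<epsilon> > 0"
    define B where "B = K * \<epsilon> powi (-2)"
    have B: "B > 0" "(z * K) / \<epsilon>\<^sup>2 = z * B" using \<open>\<epsilon> > 0\<close> assms(1)
      by (auto simp: B_def power_int_minus field_simps)
    have "ereal z = ereal (z * B) / ereal B" using B by simp
    also have "\<dots> \<le> A \<epsilon> / ereal B" using A B by (intro ereal_divide_right_mono) auto
    finally show "y < A \<epsilon> / ereal (K * \<epsilon> powi (-2))" using z'(3) unfolding B_def by (rule less_le_trans[rotated])
  qed
qed

theorem theorem4:
  fixes \<nu> :: "'x measure"
    and p :: "real^'n::finite \<Rightarrow> 'x \<Rightarrow> real"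
    and \<Theta> \<Theta>a :: "(real^'n) set"
    and r0 \<delta> :: real
    and NE :: nat
  assumes model: "statistical_model \<nu> p \<Theta> \<Theta>a"
    and score: "score_identities \<nu> p \<Theta>"
    and A1: "A1 \<nu> p \<Theta>"
    and A2: "A2 \<nu> p \<Theta>a"
    and R1: "R1 \<Theta> \<Theta>a r0"
    and R2: "R2 \<nu> p \<Theta>"
    and R3: "R3 \<nu> p \<Theta>"
    and R4: "R4 \<nu> p \<Theta> r0"
    and R5: "R5 \<nu> p \<Theta>"
    and delta: "0 < \<delta>" "\<delta> < 1 / sqrt (8 * pi * exp 1)"
    and NE: "0 < NE"
  shows "(\<lambda>\<epsilon>. ereal_of_enat (min_repetitions \<nu> p \<Theta> \<epsilon> \<delta>)) \<greatersim>
           (\<lambda>\<epsilon>. ereal (lambert_W0 (\<delta> powi (-2) / (8 * pi)) *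
                       (SUP \<theta>\<in>\<Theta>. mu_max (matrix_inv (fisher \<nu> p \<theta>))) * \<epsilon> powi (-2)))
       \<and> (\<lambda>\<epsilon>. ereal_of_enat (min_sample_complexity NE \<nu> p \<Theta> \<epsilon> \<delta>)) \<greatersim>
           (\<lambda>\<epsilon>. ereal (real NE * lambert_W0 (\<delta> powi (-2) / (8 * pi)) *
                       (SUP \<theta>\<in>\<Theta>. mu_max (matrix_inv (fisher \<nu> p \<theta>))) * \<epsilon> powi (-2)))"
proof -
  let ?W = "lambert_W0 (\<delta> powi (-2) / (8 * pi))"
  let ?\<mu> = "\<lambda>\<theta>. mu_max (matrix_inv (fisher \<nu> p \<theta>))"
  let ?S = "SUP \<theta>\<in>\<Theta>. ?\<mu> \<theta>"
  have ne: "\<Theta> \<noteq> {}" using model by (simp add: statistical_model_def)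
  note bdd = bdd_above_mu_max[OF score R2]
  have "?W > 0" using lambert_W0_gt_1[OF delta] by simp
  obtain \<theta>0 where \<theta>0: "\<theta>0 \<in> \<Theta>" using ne by blast
  have "0 < ?\<mu> \<theta>0" using fisher_eigenvector[OF score R2 \<theta>0] by blast
  also have "\<dots> \<le> ?S" by (rule cSUP_upper[OF \<theta>0 bdd])
  finally have "?S > 0" .
  have ev: "\<forall>\<^sub>F \<epsilon> in at_right 0. ereal (c / \<epsilon>\<^sup>2) \<le> ereal_of_enat (min_repetitions \<nu> p \<Theta> \<epsilon> \<delta>)"
    if c: "0 < c" "c < ?W * ?S" for c
  proof -
    \<comment> \<open>The supremum need not be attained, but a constant strictly below the bound is
      already below the value at some \<open>\<theta>\<close>, and failure at one parameter refutes
      the uniform guarantee.\<close>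
    have "c / ?W < ?S" using c \<open>?W > 0\<close> by (simp add: field_simps)
    then obtain \<theta> where \<theta>: "\<theta> \<in> \<Theta>" "c / ?W < ?\<mu> \<theta>" using less_cSUP_iff[OF ne bdd] by blast
    have "c < ?W * ?\<mu> \<theta>" using \<theta>(2) \<open>?W > 0\<close> by (simp add: field_simps)
    from not_ml_guarantee[OF model score A1 A2 R1 R2 R4 delta \<theta>(1) c(1) this]
    show ?thesis by eventually_elim (rule min_repetitions_ge)
  qed
  have ev': "\<forall>\<^sub>F \<epsilon> in at_right 0. ereal (c / \<epsilon>\<^sup>2) \<le> ereal_of_enat (min_sample_complexity NE \<nu> p \<Theta> \<epsilon> \<delta>)"
    if c: "0 < c" "c < real NE * ?W * ?S" for c
  proof -
    \<comment> \<open>Dividing the constant by the number of channel uses reduces sample complexity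
      to repetitions.\<close>
    have "\<forall>\<^sub>F \<epsilon> in at_right 0. ereal ((c / NE) / \<epsilon>\<^sup>2) \<le> ereal_of_enat (min_repetitions \<nu> p \<Theta> \<epsilon> \<delta>)"
      using c NE by (intro ev) (auto simp: field_simps)
    then show ?thesis
    proof eventually_elim
      fix \<epsilon> assume "ereal ((c / NE) / \<epsilon>\<^sup>2) \<le> ereal_of_enat (min_repetitions \<nu> p \<Theta> \<epsilon> \<delta>)"
      then have "ereal NE * ereal ((c / NE) / \<epsilon>\<^sup>2) \<le> ereal NE * ereal_of_enat (min_repetitions \<nu> p \<Theta> \<epsilon> \<delta>)"
        by (intro ereal_mult_left_mono) auto
      also have "\<dots> = ereal_of_enat (min_sample_complexity NE \<nu> p \<Theta> \<epsilon> \<delta>)"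
        by (simp add: min_sample_complexity_def ereal_of_enat_mult)
      also have "ereal NE * ereal ((c / NE) / \<epsilon>\<^sup>2) = ereal (c / \<epsilon>\<^sup>2)" using NE by simp
      finally show "ereal (c / \<epsilon>\<^sup>2) \<le> ereal_of_enat (min_sample_complexity NE \<nu> p \<Theta> \<epsilon> \<delta>)" .
    qed
  qed
  show ?thesis
    using \<open>?W > 0\<close> \<open>?S > 0\<close> NE by (intro conjI asymp_ge_inverse_square ev ev') auto
qed

end
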